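(* There exists a universal constant $C>0$ such that for every integer $d\ge2$, every $n\ge2$ of the form $n=n_1^d$ with $n_1\in\mathbb{N}$, and every $\theta_0\in\mathbb{R}^{\mathbb{L}_{d,n}}$ (not necessarily isotonic), \[ R(\hat\theta_n,\theta_0)\le\inf_{k\in\mathbb{N}}\biggl\{\inf_{\theta\in\mathcal{M}^{(k)}(\mathbb{L}_{d,n})}\frac{\|\theta-\theta_0\|_2^2}{n}+C\Bigl(\frac{k}{n}\Bigr)^{2/d}\log_+^8\Bigl(\frac nk\Bigr)\biggr\}. \]
   Context: For $n=n_1^d$, $\mathbb{L}_{d,n}:=\{1,\ldots,n_1\}^d$, partially ordered by $u\preceq v$ iff $u_j\le v_j$ for all $j$. $\mathcal{M}(\mathbb{L}_{d,n}):=\{\theta\in\mathbb{R}^{\mathbb{L}_{d,n}}:\theta_u\le\theta_v\text{ whenever }u\preceq v\}$. One observes $Y=(Y_w)_{w\in\mathbb{L}_{d,n}}$ with $Y_w=(\theta_0)_w+\epsilon_w$, where the $\epsilon_w$ are independent $N(0,1)$; $\hat\theta_n$ is the Euclidean projection of $Y$ onto $\mathcal{M}(\mathbb{L}_{d,n})$ (the least squares estimator), and $R(\hat\theta_n,\theta_0):=\mathbb{E}\bigl[\frac1n\|\hat\theta_n-\theta_0\|_2^2\bigr]$. A hyperrectangle in $\mathbb{L}_{d,n}$ is the intersection of $\mathbb{L}_{d,n}$ with a set $\prod_{j=1}^d I_j$, each $I_j\subseteq\mathbb{R}$ an interval. $\mathcal{M}^{(k)}(\mathbb{L}_{d,n})$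 is the set of all $\theta\in\mathcal{M}(\mathbb{L}_{d,n})$ for which there is a partition of $\mathbb{L}_{d,n}$ into $k$ hyperrectangles $R_1,\ldots,R_k$ such that $\theta$ is constant on each $R_\ell$. The infimum over an empty set is $+\infty$. $\log_+(x):=\log(\max(x,e))$. "Universal" means not depending on $d$, $n$ or anything else. *)

theory Defs
  imports "HOL-Probability.Probability"
begin

(* Points are extensional functions (undefined outside {1..d}), so that points of the lattice
   and coordinate vectors are in bijection.  Consequently, on lattice points, the order \<le> on
   functions is the coordinatewise order on {1..d}. *)
definition grid :: "nat \<Rightarrow> nat \<Rightarrow> (nat \<Rightarrow> nat) set" where
  "grid d n1 = {1..d} \<rightarrow>\<^sub>E {1..n1}"

definition isotone :: "nat \<Rightarrow> nat \<Rightarrow> ((nat \<Rightarrow> nat) \<Rightarrow> real) set" where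
  "isotone d n1 = {\<theta> \<in> extensional (grid d n1). mono_on (grid d n1) \<theta>}"

definition hyperrectangle :: "nat \<Rightarrow> nat \<Rightarrow> (nat \<Rightarrow> nat) set \<Rightarrow> bool" where
  "hyperrectangle d n1 R \<longleftrightarrow>
     (\<exists>I :: nat \<Rightarrow> real set. (\<forall>j\<in>{1..d}. is_interval (I j)) \<and>
        R = {u \<in> grid d n1. \<forall>j\<in>{1..d}. real (u j) \<in> I j})"

definition isotone_pieces :: "nat \<Rightarrow> nat \<Rightarrow> nat \<Rightarrow> ((nat \<Rightarrow> nat) \<Rightarrow> real) set" where
  "isotone_pieces d n1 k =
     {\<theta> \<in> isotone d n1. \<exists>P. partition_on (grid d n1) P \<and> finite P \<and> card P = k \<and>
        (\<forall>R\<in>P. hyperrectangle d n1 R \<and> \<theta> constant_on R)}"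

(* Euclidean projection of y onto the closed convex cone of isotone functions, hence the
   minimiser is unique. *)
definition lse :: "nat \<Rightarrow> nat \<Rightarrow> ((nat \<Rightarrow> nat) \<Rightarrow> real) \<Rightarrow> (nat \<Rightarrow> nat) \<Rightarrow> real" where
  "lse d n1 y = arg_min_on (\<lambda>\<theta>. L2_set (\<lambda>w. y w - \<theta> w) (grid d n1)) (isotone d n1)"

definition noise :: "nat \<Rightarrow> nat \<Rightarrow> ((nat \<Rightarrow> nat) \<Rightarrow> real) measure" where
  "noise d n1 = (\<Pi>\<^sub>M w\<in>grid d n1. density lborel std_normal_density)"

(* The product measure is the joint law of any independent standard normal family, on an
   arbitrary probability space. *)
lemma (in prob_space) distr_noise:
  assumes "indep_vars (\<lambda>_. borel) \<epsilon> (grid d n1)"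
    and "\<And>w. w \<in> grid d n1 \<Longrightarrow> distributed M lborel (\<epsilon> w) std_normal_density"
    and "grid d n1 \<noteq> {}"
  shows "distr M (\<Pi>\<^sub>M w\<in>grid d n1. borel) (\<lambda>x. \<lambda>w\<in>grid d n1. \<epsilon> w x) = noise d n1"
proof -
  have rv: "random_variable borel (\<epsilon> w)" if "w \<in> grid d n1" for w
    using assms(2)[OF that] by (simp add: distributed_def)
  have law: "distr M borel (\<epsilon> w) = density lborel std_normal_density" if "w \<in> grid d n1" for w
    using assms(2)[OF that] distr_cong[of M M borel lborel "\<epsilon> w" "\<epsilon> w"]
    by (simp add: distributed_def)
  have "distr M (\<Pi>\<^sub>M w\<in>grid d n1. borel) (\<lambda>x. \<lambda>w\<in>grid d n1. \<epsilon> w x) =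
      (\<Pi>\<^sub>M w\<in>grid d n1. distr M borel (\<epsilon> w))"
    using assms(1) by (subst (asm) indep_vars_iff_distr_eq_PiM'[OF assms(3) rv]) auto
  also have "\<dots> = noise d n1"
    unfolding noise_def by (rule PiM_cong) (auto simp: law)
  finally show ?thesis .
qed

(* The nonnegative integral, so that no value is imposed by convention on a non-integrable loss. *)
definition risk :: "nat \<Rightarrow> nat \<Rightarrow> ((nat \<Rightarrow> nat) \<Rightarrow> real) \<Rightarrow> ennreal" where
  "risk d n1 \<theta>0 =
     (\<integral>\<^sup>+ \<epsilon>. ennreal ((L2_set (\<lambda>w. lse d n1 (\<lambda>v. \<theta>0 v + \<epsilon> v) w - \<theta>0 w) (grid d n1))\<^sup>2
        / real (n1 ^ d)) \<partial>noise d n1)"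

definition log_plus :: "real \<Rightarrow> real" where
  "log_plus x = ln (max x (exp 1))"

end

theory Submission
  imports Defs
begin

text \<open>
Write \<open>h\<close> for the estimator, \<open>\<epsilon>\<close> for the noise and \<open>v = h - \<theta>\<close>, where \<open>\<theta>\<close> is isotone and constant on
each of \<open>k\<close> hyperrectangles. Because \<open>h\<close> is a projection onto a convex set, the loss of \<open>h\<close> exceeds that
of \<open>\<theta>\<close> by at most \<open>2 \<langle>\<epsilon>, v\<rangle> - \<parallel>v\<parallel>\<^sup>2\<close> (\<open>oracle_inequality\<close>). This quantity is a sum over the blocks, and on
every block \<open>v\<close> is isotone. So it suffices to bound the expectation of its supremum over all isotone
functions \<open>v\<close> on a single block.

A block is cut into two-dimensional slices along its two longest sides. Keeping only the order inside
slices enlarges the class of functions, but does not change the rate: each slice contributes a power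
of a logarithm, and a block of \<open>N\<close> points has at most \<open>N powr (1 - 2 / d)\<close> slices (\<open>noise_block\<close>,
\<open>exists_two_long_sides\<close>). Summing over the blocks gives \<open>n * (k / n) powr (2 / d)\<close> up to logarithms
(\<open>block_rate\<close>). As the only high-dimensional step is this slicing, the constant is universal.

The heart is the planar case. It is handled deterministically: if every rectangle sum of the noise
is at most \<open>M\<close> times the square root of the area, then an isotone \<open>f\<close> on a \<open>p \<times> q\<close> grid satisfies
\<open>\<bar>\<langle>\<epsilon>, f\<rangle>\<bar> \<le> 4 * M * A ^ 3 * \<parallel>f\<parallel>\<close> with \<open>A\<close> of order \<open>ln (p * q)\<close> (\<open>isotone_inner_bound\<close>). After splitting into positive and
negative part, \<open>f\<close> is antitone and nonnegative. Then dyadic blocks around the corner reduce the claim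
to bounded functions: on a block, the maximum of \<open>f\<close> times the square root of the area is at most
\<open>\<parallel>f\<parallel>\<close> (\<open>antitone_inner_bound\<close>). A chaining over dyadic scales inside a block works because a monotone function on \<open>N \<times> N\<close> cells changes by only \<open>O(N)\<close>
times its maximum in total (\<open>square_chaining\<close>). No entropy bounds or suprema of Gaussian processes
beyond a union bound over rectangles are involved: that union bound makes \<open>M\<^sup>2\<close> of order
\<open>ln (p * q)\<close> in expectation (\<open>nn_integral_sup_sq_bound\<close>), for \<open>ln (p * q) ^ 7\<close> per slice in total.
\<close>

section \<open>Isotone functions against noise with small rectangle sums\<close>

text \<open>This is the only property of the noise that the deterministic part uses: with high probability it
holds with \<open>M\<close> of order the square root of a logarithm, because a rectangle sum of independent
standard normals has variance equal to the area, and there are only polynomially many rectangles.\<close>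

definition rect_bounded :: "real \<Rightarrow> (nat \<Rightarrow> nat \<Rightarrow> real) \<Rightarrow> bool" where
  "rect_bounded M e \<longleftrightarrow>
     (\<forall>x y m n. \<bar>\<Sum>i<m. \<Sum>j<n. e (x + i) (y + j)\<bar> \<le> M * sqrt (real m * real n))"

definition antitone2 :: "(nat \<Rightarrow> nat \<Rightarrow> real) \<Rightarrow> bool" where
  "antitone2 g \<longleftrightarrow> (\<forall>x x' y y'. x \<le> x' \<longrightarrow> y \<le> y' \<longrightarrow> g x' y' \<le> g x y)"

lemma rect_boundedD:
  "rect_bounded M e \<Longrightarrow> \<bar>\<Sum>i<m. \<Sum>j<n. e (x + i) (y + j)\<bar> \<le> M * sqrt (real m * real n)"
  by (simp add: rect_bounded_def)

lemma rect_bounded_entry: "rect_bounded M e \<Longrightarrow> \<bar>e x y\<bar> \<le> M"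
  using rect_boundedD[where m = 1 and n = 1 and x = x and y = y and M = M and e = e] by simp

lemma rect_bounded_nonneg: "rect_bounded M e \<Longrightarrow> 0 \<le> M"
  using rect_bounded_entry[of M e 0 0] by simp

lemma rect_bounded_shift: "rect_bounded M e \<Longrightarrow> rect_bounded M (\<lambda>x y. e (u + x) (v + y))"
  unfolding rect_bounded_def by (simp add: add.assoc[symmetric])

lemma rect_bounded_transpose: "rect_bounded M e \<Longrightarrow> rect_bounded M (\<lambda>x y. e y x)"
  unfolding rect_bounded_def
  by (subst sum.swap) (metis mult.commute)

lemma antitone2D: "antitone2 g \<Longrightarrow> x \<le> x' \<Longrightarrow> y \<le> y' \<Longrightarrow> g x' y' \<le> g x y"
  by (simp add: antitone2_def)

lemma sum_lessThan_add:
  fixes f :: "nat \<Rightarrow> 'a :: comm_monoid_add"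
  shows "(\<Sum>i<a + b. f i) = (\<Sum>i<a. f i) + (\<Sum>i<b. f (a + i))"
  by (induction b) (auto simp: add.assoc)

lemma abs_sum_grid_le:
  fixes f b :: "nat \<Rightarrow> nat \<Rightarrow> real"
  assumes "\<And>i j. i < m \<Longrightarrow> j < n \<Longrightarrow> \<bar>f i j\<bar> \<le> b i j"
  shows "\<bar>\<Sum>i<m. \<Sum>j<n. f i j\<bar> \<le> (\<Sum>i<m. \<Sum>j<n. b i j)"
  using assms by (intro sum_abs[THEN order.trans] sum_mono) simp_all

lemma sum_lessThan_mult:
  fixes f :: "nat \<Rightarrow> 'a :: comm_monoid_add"
  shows "(\<Sum>i<m * s. f i) = (\<Sum>i<m. \<Sum>r<s. f (i * s + r))"
  by (induction m) (auto simp: add.commute[of s] sum_lessThan_add)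

lemma sum_grid_mult:
  fixes f :: "nat \<Rightarrow> nat \<Rightarrow> 'a :: comm_monoid_add"
  shows "(\<Sum>i<m * s. \<Sum>j<n * c. f i j) = (\<Sum>i<m. \<Sum>j<n. \<Sum>r<s. \<Sum>t<c. f (i * s + r) (j * c + t))"
proof -
  have "(\<Sum>r<s. \<Sum>j<n. \<Sum>t<c. f (i * s + r) (j * c + t))
      = (\<Sum>j<n. \<Sum>r<s. \<Sum>t<c. f (i * s + r) (j * c + t))" for i
    by (rule sum.swap)
  then show ?thesis by (simp add: sum_lessThan_mult)
qed

text \<open>Merging \<open>s \<times> c\<close> cells into one turns rectangles into rectangles of \<open>s * c\<close> times the area. This
scale invariance is what allows induction over dyadic scales below.\<close>

lemma rect_bounded_coarsen:
  assumes "rect_bounded M e"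
  shows "rect_bounded (M * sqrt (real s * real c)) (\<lambda>i j. \<Sum>r<s. \<Sum>t<c. e (i * s + r) (j * c + t))"
  unfolding rect_bounded_def
proof (intro allI)
  fix x y m n
  have "(\<Sum>i<m. \<Sum>j<n. \<Sum>r<s. \<Sum>t<c. e ((x + i) * s + r) ((y + j) * c + t))
      = (\<Sum>i<m * s. \<Sum>j<n * c. e (x * s + i) (y * c + j))"
    unfolding sum_grid_mult by (simp add: add_mult_distrib add.assoc)
  also have "\<bar>\<dots>\<bar> \<le> M * sqrt (real (m * s) * real (n * c))"
    using assms by (rule rect_boundedD)
  also have "\<dots> = M * sqrt (real s * real c) * sqrt (real m * real n)"
    by (simp add: real_sqrt_mult)
  finally show "\<bar>\<Sum>i<m. \<Sum>j<n. \<Sum>r<s. \<Sum>t<c. e ((x + i) * s + r) ((y + j) * c + t)\<bar>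
      \<le> M * sqrt (real s * real c) * sqrt (real m * real n)" .
qed

text \<open>The sum telescopes along the diagonals, of which there are \<open>2 * N - 1\<close>, and each diagonal contributes
at most the maximal value \<open>h 0 0\<close>. (On the two edges, truncated subtraction repeats the edge value,
which adds nothing that exceeds this.) So although the sum has \<open>N\<^sup>2\<close> terms, its size is only of
the order of \<open>N\<close> times the maximum.\<close>

lemma sum_diagonal_increments_le:
  assumes h: "antitone2 h" and nn: "\<And>x y. 0 \<le> h x y" and "0 < N"
  shows "(\<Sum>i<N. \<Sum>j<N. h (i - 1) (j - 1) - h i j) \<le> 2 * real N * h 0 0"
proof -
  obtain K where N: "N = Suc K" using \<open>0 < N\<close> gr0_conv_Suc by auto
  have "(\<Sum>i<N. \<Sum>j<N. h (i - 1) (j - 1)) 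
     = (\<Sum>j<Suc K. h 0 (j - 1)) + (\<Sum>i<K. \<Sum>j<Suc K. h i (j - 1))"
    unfolding N by (subst sum.lessThan_Suc_shift) simp
  also have "(\<Sum>i<K. \<Sum>j<Suc K. h i (j - 1)) = (\<Sum>i<K. h i 0) + (\<Sum>i<K. \<Sum>j<K. h i j)"
    by (simp add: sum.lessThan_Suc_shift sum.distrib del: sum.lessThan_Suc)
  also have "(\<Sum>j<Suc K. h 0 (j - 1)) \<le> (\<Sum>j<Suc K. h 0 0)"
    by (intro sum_mono antitone2D[OF h]) auto
  also have "(\<Sum>i<K. h i 0) \<le> (\<Sum>i<K. h 0 0)"
    by (intro sum_mono antitone2D[OF h]) auto
  also have "(\<Sum>i<K. \<Sum>j<K. h i j) \<le> (\<Sum>i<N. \<Sum>j<N. h i j)"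
    unfolding N using nn by (simp add: sum.distrib sum_nonneg add_nonneg_nonneg)
  finally have "(\<Sum>i<N. \<Sum>j<N. h (i - 1) (j - 1)) \<le> 
     (\<Sum>j<Suc K. h 0 0) + ((\<Sum>i<K. h 0 0) + (\<Sum>i<N. \<Sum>j<N. h i j))" by simp
  also have "\<dots> \<le> 2 * real N * h 0 0 + (\<Sum>i<N. \<Sum>j<N. h i j)"
    using nn[of 0 0] by (simp add: N algebra_simps)
  finally show ?thesis by (simp add: sum_subtractf)
qed

text \<open>Chaining over dyadic scales. Replacing \<open>h\<close> on every \<open>2 \<times> 2\<close> cell by its value at the lower corner costs
\<open>M\<close> times the diagonal variation, at most \<open>2 * M * h 0 0 * 2 ^ (l + 1)\<close>. What remains is the same
problem at half the resolution, with noise level \<open>2 * M\<close>. Hence every one of the \<open>l\<close> scales contributes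
the same amount, and the loss compared with a single rectangle sum is linear in \<open>l\<close>.\<close>

lemma square_chaining:
  assumes "rect_bounded M e" "antitone2 h" "\<And>x y. 0 \<le> h x y"
  shows "\<bar>\<Sum>i<2 ^ l. \<Sum>j<2 ^ l. h i j * e i j\<bar> \<le> M * h 0 0 * 2 ^ l * (2 * real l + 1)"
  using assms
proof (induction l arbitrary: M e h)
  case 0
  then show ?case
    using mult_left_mono[OF rect_bounded_entry[of M e 0 0], of "h 0 0"]
    by (simp add: abs_mult mult.commute)
next
  case (Suc l)
  define e' where "e' = (\<lambda>i j. \<Sum>r<2. \<Sum>t<2. e (i * 2 + r) (j * 2 + t))"
  define h' where "h' = (\<lambda>i j. h (i * 2) (j * 2))"
  define N :: nat where "N = 2 ^ Suc l"
  have M: "0 \<le> M" using Suc.prems(1) by (rule rect_bounded_nonneg)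
  have e': "rect_bounded (M * 2) e'"
    using rect_bounded_coarsen[OF Suc.prems(1), of 2 2] by (simp add: e'_def)
  have h': "antitone2 h'" "\<And>x y. 0 \<le> h' x y"
    using Suc.prems(2,3) by (auto simp: h'_def antitone2_def)
  have N2: "N = 2 ^ l * 2" by (simp add: N_def)
  \<comment> \<open>Here \<open>2 * (i div 2)\<close> is the lower end of the pair that contains \<open>i\<close>.\<close>
  have coarse: "(\<Sum>i<N. \<Sum>j<N. h (2 * (i div 2)) (2 * (j div 2)) * e i j)
      = (\<Sum>i<2 ^ l. \<Sum>j<2 ^ l. h' i j * e' i j)"
    unfolding N2 sum_grid_mult
  proof (intro sum.cong refl)
    fix i j
    have "h (2 * ((i * 2 + r) div 2)) (2 * ((j * 2 + t) div 2)) = h' i j" if "r < 2" "t < 2" for r t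
      using that by (simp add: h'_def mult.commute)
    then show "(\<Sum>r<2. \<Sum>t<2. h (2 * ((i * 2 + r) div 2)) (2 * ((j * 2 + t) div 2)) * e (i * 2 + r) (j * 2 + t))
        = h' i j * e' i j"
      by (simp add: e'_def sum_distrib_left)
  qed
  have "\<bar>\<Sum>i<N. \<Sum>j<N. (h (2 * (i div 2)) (2 * (j div 2)) - h i j) * e i j\<bar>
      \<le> (\<Sum>i<N. \<Sum>j<N. (h (i - 1) (j - 1) - h i j) * M)"
  proof (rule abs_sum_grid_le)
    fix i j :: nat
    have d: "2 * (i div 2) \<le> i" "i - 1 \<le> 2 * (i div 2)" "2 * (j div 2) \<le> j" "j - 1 \<le> 2 * (j div 2)"
      by auto
    have "\<bar>h (2 * (i div 2)) (2 * (j div 2)) - h i j\<bar> \<le> h (i - 1) (j - 1) - h i j"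
      using antitone2D[OF Suc.prems(2) d(1,3)] antitone2D[OF Suc.prems(2) d(2,4)] by linarith
    then show "\<bar>(h (2 * (i div 2)) (2 * (j div 2)) - h i j) * e i j\<bar> \<le> (h (i - 1) (j - 1) - h i j) * M"
      using rect_bounded_entry[OF Suc.prems(1), of i j] by (auto simp: abs_mult intro!: mult_mono)
  qed
  also have "\<dots> = M * (\<Sum>i<N. \<Sum>j<N. h (i - 1) (j - 1) - h i j)"
    by (simp add: sum_distrib_left mult.commute)
  also have "\<dots> \<le> M * (2 * real N * h 0 0)"
    using sum_diagonal_increments_le[OF Suc.prems(2,3), of N] M by (simp add: N_def mult_left_mono)
  finally have fine: "\<bar>\<Sum>i<N. \<Sum>j<N. (h (2 * (i div 2)) (2 * (j div 2)) - h i j) * e i j\<bar>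
      \<le> M * (2 * real N * h 0 0)" .
  have "(\<Sum>i<N. \<Sum>j<N. h i j * e i j) = (\<Sum>i<2 ^ l. \<Sum>j<2 ^ l. h' i j * e' i j)
      - (\<Sum>i<N. \<Sum>j<N. (h (2 * (i div 2)) (2 * (j div 2)) - h i j) * e i j)"
    unfolding coarse[symmetric] by (simp add: sum_subtractf algebra_simps)
  then have "\<bar>\<Sum>i<N. \<Sum>j<N. h i j * e i j\<bar>
      \<le> M * 2 * h' 0 0 * 2 ^ l * (2 * real l + 1) + M * (2 * real N * h 0 0)"
    using Suc.IH[OF e' h'] fine by linarith
  also have "\<dots> = M * h 0 0 * 2 ^ Suc l * (2 * real (Suc l) + 1)"
    by (simp add: h'_def N_def algebra_simps)
  finally show ?case by (simp add: N_def)
qed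


text \<open>Summation by parts expresses the sum through tail sums of \<open>e\<close>, with the nonnegative weights
\<open>f k - f (k + 1)\<close>.\<close>

lemma abel_bound:
  fixes f e :: "nat \<Rightarrow> real"
  assumes f: "antimono f" and e: "\<And>k m. k + m \<le> n \<Longrightarrow> \<bar>\<Sum>i<m. e (k + i)\<bar> \<le> B"
  shows "\<bar>\<Sum>i<n. (f 0 - f i) * e i\<bar> \<le> (f 0 - f n) * B"
proof -
  have abel: "(\<Sum>i<m. (f 0 - f i) * e i)
      = (\<Sum>k<m. (f k - f (Suc k)) * ((\<Sum>i<m. e i) - (\<Sum>i<Suc k. e i)))" for m
  proof (induction m)
    case (Suc m)
    have "(\<Sum>k<Suc m. (f k - f (Suc k)) * ((\<Sum>i<Suc m. e i) - (\<Sum>i<Suc k. e i)))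
       = (\<Sum>k<m. (f k - f (Suc k)) * ((\<Sum>i<m. e i) - (\<Sum>i<Suc k. e i)) + (f k - f (Suc k)) * e m)"
      by (simp add: algebra_simps)
    also have "\<dots> = (\<Sum>i<m. (f 0 - f i) * e i) + (f 0 - f m) * e m"
      by (simp add: sum.distrib Suc.IH sum_distrib_right[symmetric] sum_lessThan_telescope')
    finally show ?case by simp
  qed simp
  have "\<bar>\<Sum>i<n. (f 0 - f i) * e i\<bar> \<le> (\<Sum>k<n. (f k - f (Suc k)) * B)"
    unfolding abel
  proof (intro order.trans[OF sum_abs] sum_mono)
    fix k assume "k \<in> {..<n}"
    then have n: "n = Suc k + (n - Suc k)" by simp
    have "(\<Sum>i<n. e i) - (\<Sum>i<Suc k. e i) = (\<Sum>i<n - Suc k. e (Suc k + i))"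
      by (subst n, subst sum_lessThan_add) simp
    then have "\<bar>(\<Sum>i<n. e i) - (\<Sum>i<Suc k. e i)\<bar> \<le> B"
      using e[of "Suc k" "n - Suc k"] n by simp
    moreover have "f (Suc k) \<le> f k" using f by (simp add: antimonoD)
    ultimately show "\<bar>(f k - f (Suc k)) * ((\<Sum>i<n. e i) - (\<Sum>i<Suc k. e i))\<bar> \<le> (f k - f (Suc k)) * B"
      by (simp add: abs_mult mult_left_mono del: sum.lessThan_Suc)
  qed
  also have "\<dots> = (f 0 - f n) * B"
    by (simp add: sum_distrib_right[symmetric] sum_lessThan_telescope')
  finally show ?thesis .
qed

text \<open>An elongated block is cut into \<open>2 ^ a \<times> 2 ^ a\<close> cells of shape \<open>1 \<times> c\<close>. The cells form a square problem.
Within a cell the function depends on one variable only, so summation by parts applies, and the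
variations of the cells telescope along each row to at most \<open>h 0 0\<close>.\<close>

lemma strip_chaining:
  assumes e: "rect_bounded M e" and h: "antitone2 h" and nn: "\<And>x y. 0 \<le> h x y"
  shows "\<bar>\<Sum>i<2 ^ a. \<Sum>j<2 ^ a * c. h i j * e i j\<bar>
      \<le> M * h 0 0 * (2 ^ a * sqrt (real c)) * (2 * real a + 2)"
proof -
  define N :: nat where "N = 2 ^ a"
  define e' where "e' = (\<lambda>i j. \<Sum>r<1. \<Sum>t<c. e (i * 1 + r) (j * c + t))"
  define h' where "h' = (\<lambda>i j. h i (j * c))"
  have M: "0 \<le> M * sqrt (real c)" using rect_bounded_nonneg[OF e] by simp
  have e': "rect_bounded (M * sqrt (real c)) e'"
    using rect_bounded_coarsen[OF e, of 1 c] by (simp add: e'_def)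
  have h': "antitone2 h'" "\<And>x y. 0 \<le> h' x y"
    using h nn by (auto simp: h'_def antitone2_def)
  have split: "(\<Sum>i<N. \<Sum>j<N * c. h i j * e i j)
      = (\<Sum>i<N. \<Sum>j<N. h' i j * e' i j)
        - (\<Sum>i<N. \<Sum>j<N. \<Sum>t<c. (h i (j * c) - h i (j * c + t)) * e i (j * c + t))"
    unfolding sum_lessThan_mult
    by (simp add: h'_def e'_def sum_distrib_left sum_subtractf left_diff_distrib)
  have "\<bar>\<Sum>i<N. \<Sum>j<N. \<Sum>t<c. (h i (j * c) - h i (j * c + t)) * e i (j * c + t)\<bar>
     \<le> (\<Sum>i<N. \<Sum>j<N. (h' i j - h' i (Suc j)) * (M * sqrt (real c)))"
  proof (rule abs_sum_grid_le)
    fix i j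
    have "\<bar>\<Sum>t<c. (h i (j * c + 0) - h i (j * c + t)) * e i (j * c + t)\<bar>
       \<le> (h i (j * c + 0) - h i (j * c + c)) * (M * sqrt (real c))"
    proof (rule abel_bound)
      show "antimono (\<lambda>t. h i (j * c + t))"
        by (intro antimonoI antitone2D[OF h]) auto
      fix k m assume "k + m \<le> c"
      have "\<bar>\<Sum>t<m. e i (j * c + k + t)\<bar> \<le> M * sqrt (real m)"
        using rect_boundedD[OF e, where m = 1 and n = m and x = i and y = "j * c + k"] by simp
      also have "\<dots> \<le> M * sqrt (real c)"
        using rect_bounded_nonneg[OF e] \<open>k + m \<le> c\<close> by (intro mult_left_mono) auto
      finally show "\<bar>\<Sum>t<m. e i (j * c + (k + t))\<bar> \<le> M * sqrt (real c)"
        by (simp add: add.assoc)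
    qed
    then show "\<bar>\<Sum>t<c. (h i (j * c) - h i (j * c + t)) * e i (j * c + t)\<bar>
       \<le> (h' i j - h' i (Suc j)) * (M * sqrt (real c))"
      by (simp add: h'_def add.commute)
  qed
  also have "\<dots> = (\<Sum>i<N. h' i 0 - h' i N) * (M * sqrt (real c))"
    by (simp add: sum_distrib_right[symmetric] sum_lessThan_telescope')
  also have "\<dots> \<le> (\<Sum>i<N. h 0 0) * (M * sqrt (real c))"
  proof (intro mult_right_mono sum_mono M)
    fix i
    show "h' i 0 - h' i N \<le> h 0 0"
      using antitone2D[OF h, of 0 i 0 0] h'(2)[of i N] by (simp add: h'_def)
  qed
  finally have fine: "\<bar>\<Sum>i<N. \<Sum>j<N. \<Sum>t<c. (h i (j * c) - h i (j * c + t)) * e i (j * c + t)\<bar>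
      \<le> real N * h 0 0 * (M * sqrt (real c))" by simp
  have "\<bar>\<Sum>i<N. \<Sum>j<N. h' i j * e' i j\<bar> \<le> M * sqrt (real c) * h' 0 0 * 2 ^ a * (2 * real a + 1)"
    unfolding N_def by (rule square_chaining[OF e' h'])
  with fine have "\<bar>\<Sum>i<N. \<Sum>j<N * c. h i j * e i j\<bar>
      \<le> M * sqrt (real c) * h' 0 0 * 2 ^ a * (2 * real a + 1) + real N * h 0 0 * (M * sqrt (real c))"
    unfolding split by linarith
  also have "\<dots> = M * h 0 0 * (2 ^ a * sqrt (real c)) * (2 * real a + 2)"
    by (simp add: h'_def N_def algebra_simps)
  finally show ?thesis by (simp add: N_def)
qed

lemma block_chaining:
  assumes e: "rect_bounded M e" and h: "antitone2 h" and nn: "\<And>x y. 0 \<le> h x y"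
  shows "\<bar>\<Sum>i<2 ^ a. \<Sum>j<2 ^ b. h i j * e i j\<bar>
      \<le> M * (h 0 0 * sqrt (2 ^ a * 2 ^ b)) * (2 * real (min a b) + 2)"
proof -
  have le: "\<bar>\<Sum>i<2 ^ a. \<Sum>j<2 ^ b. h i j * e i j\<bar>
      \<le> M * (h 0 0 * sqrt (2 ^ a * 2 ^ b)) * (2 * real a + 2)"
    if "a \<le> b" "rect_bounded M e" "antitone2 h" "\<And>x y. 0 \<le> h x y" for a b :: nat and e h
  proof -
    have b: "(2::nat) ^ b = 2 ^ a * 2 ^ (b - a)" "(2::real) ^ b = 2 ^ a * 2 ^ (b - a)"
      using \<open>a \<le> b\<close> by (simp_all add: power_add[symmetric])
    have "sqrt (2 ^ a * 2 ^ b) = 2 ^ a * sqrt (real (2 ^ (b - a)))"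
      unfolding b(2) by (simp add: real_sqrt_mult)
    then show ?thesis
      using strip_chaining[OF that(2-4), of a "2 ^ (b - a)"] unfolding b(1) by (simp add: mult.assoc)
  qed
  show ?thesis
  proof (cases "a \<le> b")
    case True
    then show ?thesis using le[OF True e h nn] by (simp add: min_absorb1)
  next
    case False
    have "antitone2 (\<lambda>x y. h y x)" using h by (auto simp: antitone2_def)
    then show ?thesis
      using le[of b a "\<lambda>x y. e y x" "\<lambda>x y. h y x"] False nn rect_bounded_transpose[OF e]
      by (subst sum.swap) (simp add: mult.commute min_absorb2)
  qed
qed

lemma sum_dyadic_blocks:
  fixes f :: "nat \<Rightarrow> 'a :: comm_monoid_add"
  shows "(\<Sum>x<2 ^ A - 1. f x) = (\<Sum>a<A. \<Sum>i<2 ^ a. f (2 ^ a - 1 + i))"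
proof (induction A)
  case (Suc A)
  have "(2 :: nat) ^ Suc A - 1 = (2 ^ A - 1) + 2 ^ A"
    by (simp add: Suc_leI)
  then show ?case by (simp only: sum_lessThan_add Suc.IH sum.lessThan_Suc)
qed simp

lemma sum_grid_dyadic_blocks:
  fixes f :: "nat \<Rightarrow> nat \<Rightarrow> 'a :: comm_monoid_add"
  shows "(\<Sum>x<2 ^ A - 1. \<Sum>y<2 ^ A - 1. f x y)
    = (\<Sum>a<A. \<Sum>b<A. \<Sum>i<2 ^ a. \<Sum>j<2 ^ b. f (2 ^ a - 1 + i) (2 ^ b - 1 + j))"
proof -
  have "(\<Sum>i<2 ^ a. \<Sum>b<A. \<Sum>j<2 ^ b. f (2 ^ a - 1 + i) (2 ^ b - 1 + j))
      = (\<Sum>b<A. \<Sum>i<2 ^ a. \<Sum>j<2 ^ b. f (2 ^ a - 1 + i) (2 ^ b - 1 + j))" for a :: nat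
    by (rule sum.swap)
  then show ?thesis by (simp only: sum_dyadic_blocks)
qed

text \<open>Cutting both axes at the points \<open>2 ^ a - 1\<close> gives blocks \<open>(a, b)\<close> of shape \<open>2 ^ a \<times> 2 ^ b\<close>. Since \<open>g\<close> is
antitone, its value at the lower corner of such a block is dominated by \<open>g\<close> on the rectangle between
the origin and that corner, which has the same area \<open>2 ^ a * 2 ^ b\<close> as the block. Hence the corner
value times the square root of the area is at most the \<open>L\<^sup>2\<close> norm of \<open>g\<close>, and the bound for a block is
free of its size up to a factor linear in \<open>A\<close>; there are \<open>A\<^sup>2\<close> blocks.\<close>

lemma antitone_inner_bound:
  assumes e: "rect_bounded M e" and g: "antitone2 g" and nn: "\<And>x y. 0 \<le> g x y"
  shows "\<bar>\<Sum>x<2 ^ A - 1. \<Sum>y<2 ^ A - 1. g x y * e x y\<bar>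
     \<le> 2 * M * real A ^ 3 * sqrt (\<Sum>x<2 ^ A - 1. \<Sum>y<2 ^ A - 1. (g x y)\<^sup>2)"
proof -
  define G where "G = sqrt (\<Sum>x<2 ^ A - 1. \<Sum>y<2 ^ A - 1. (g x y)\<^sup>2)"
  have M: "0 \<le> M" using e by (rule rect_bounded_nonneg)
  have "0 \<le> G" unfolding G_def by (simp add: sum_nonneg)
  have corner: "g (2 ^ a - 1) (2 ^ b - 1) * sqrt (2 ^ a * 2 ^ b) \<le> G" if "a < A" "b < A" for a b
  proof -
    have "(2::nat) ^ a < 2 ^ A" "(2::nat) ^ b < 2 ^ A" using that by simp_all
    then have ab: "(2::nat) ^ a \<le> 2 ^ A - 1" "(2::nat) ^ b \<le> 2 ^ A - 1" by linarith+
    have "(g (2 ^ a - 1) (2 ^ b - 1))\<^sup>2 * (2 ^ a * 2 ^ b)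
        = (\<Sum>x<(2::nat) ^ a. \<Sum>y<(2::nat) ^ b. (g (2 ^ a - 1) (2 ^ b - 1))\<^sup>2)"
      by simp
    also have "\<dots> \<le> (\<Sum>x<2 ^ a. \<Sum>y<2 ^ b. (g x y)\<^sup>2)"
      by (intro sum_mono power_mono antitone2D[OF g] nn) auto
    also have "\<dots> \<le> (\<Sum>x<2 ^ A - 1. \<Sum>y<2 ^ b. (g x y)\<^sup>2)"
      using ab by (intro sum_mono2) (auto intro!: sum_nonneg)
    also have "\<dots> \<le> (\<Sum>x<2 ^ A - 1. \<Sum>y<2 ^ A - 1. (g x y)\<^sup>2)"
      using ab by (intro sum_mono sum_mono2) auto
    finally have "sqrt ((g (2 ^ a - 1) (2 ^ b - 1))\<^sup>2 * (2 ^ a * 2 ^ b)) \<le> G"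
      unfolding G_def by (rule real_sqrt_le_mono)
    then show ?thesis using nn by (simp add: real_sqrt_mult)
  qed
  have "\<bar>\<Sum>x<2 ^ A - 1. \<Sum>y<2 ^ A - 1. g x y * e x y\<bar>
     \<le> (\<Sum>a<A. \<Sum>b<A. M * G * (2 * real A))"
    unfolding sum_grid_dyadic_blocks
  proof (rule abs_sum_grid_le)
    fix a b assume ab: "a < A" "b < A"
    have h: "antitone2 (\<lambda>i j. g (2 ^ a - 1 + i) (2 ^ b - 1 + j))"
      using g by (auto simp: antitone2_def)
    have "\<bar>\<Sum>i<2 ^ a. \<Sum>j<2 ^ b. g (2 ^ a - 1 + i) (2 ^ b - 1 + j) * e (2 ^ a - 1 + i) (2 ^ b - 1 + j)\<bar>
        \<le> M * (g (2 ^ a - 1 + 0) (2 ^ b - 1 + 0) * sqrt (2 ^ a * 2 ^ b)) * (2 * real (min a b) + 2)"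
      by (rule block_chaining[OF rect_bounded_shift[OF e] h nn])
    also have "\<dots> \<le> M * G * (2 * real A)"
      using ab corner[of a b] M nn \<open>0 \<le> G\<close>
      by (intro mult_mono) (auto intro!: mult_left_mono mult_nonneg_nonneg simp: min_def)
    finally show "\<bar>\<Sum>i<2 ^ a. \<Sum>j<2 ^ b. g (2 ^ a - 1 + i) (2 ^ b - 1 + j) * e (2 ^ a - 1 + i) (2 ^ b - 1 + j)\<bar>
        \<le> M * G * (2 * real A)" .
  qed
  also have "\<dots> = 2 * M * real A ^ 3 * G" by (simp add: power3_eq_cube)
  finally show ?thesis unfolding G_def .
qed

lemma sum_lessThan_clip:
  fixes f :: "nat \<Rightarrow> 'a :: comm_monoid_add"
  shows "(\<Sum>i<m. if x + i < p then f i else 0) = (\<Sum>i<min m (p - x). f i)"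
  by (intro sum.mono_neutral_cong_right) auto

lemma rect_bounded_extend:
  assumes e: "\<And>x y m n. x + m \<le> p \<Longrightarrow> y + n \<le> q \<Longrightarrow>
      \<bar>\<Sum>i<m. \<Sum>j<n. e (x + i) (y + j)\<bar> \<le> M * sqrt (real m * real n)"
    and M: "0 \<le> M"
  shows "rect_bounded M (\<lambda>x y. if x < p \<and> y < q then e x y else 0)"
  unfolding rect_bounded_def
proof (intro allI)
  fix x y m n
  have "(\<Sum>i<m. \<Sum>j<n. if x + i < p \<and> y + j < q then e (x + i) (y + j) else 0)
     = (\<Sum>i<m. if x + i < p then (\<Sum>j<n. if y + j < q then e (x + i) (y + j) else 0) else 0)"
    by (intro sum.cong refl) auto
  also have "\<dots> = (\<Sum>i<min m (p - x). \<Sum>j<min n (q - y). e (x + i) (y + j))"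
    by (simp only: sum_lessThan_clip)
  also have "\<bar>\<dots>\<bar> \<le> M * sqrt (real (min m (p - x)) * real (min n (q - y)))"
  proof (cases "x \<le> p \<and> y \<le> q")
    case True
    then show ?thesis by (intro e) auto
  next
    case False
    then have "p - x = 0 \<or> q - y = 0" by auto
    then show ?thesis by auto
  qed
  also have "\<dots> \<le> M * sqrt (real m * real n)"
    using M by (intro mult_left_mono real_sqrt_le_mono mult_mono) auto
  finally show "\<bar>\<Sum>i<m. \<Sum>j<n. if x + i < p \<and> y + j < q then e (x + i) (y + j) else 0\<bar>
      \<le> M * sqrt (real m * real n)" .
qed

lemma antitone_inner_bound_rectangle:
  assumes e: "\<And>x y m n. x + m \<le> p \<Longrightarrow> y + n \<le> q \<Longrightarrow>
      \<bar>\<Sum>i<m. \<Sum>j<n. e (x + i) (y + j)\<bar> \<le> M * sqrt (real m * real n)"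
    and M: "0 \<le> M"
    and g: "\<And>x x' y y'. x \<le> x' \<Longrightarrow> y \<le> y' \<Longrightarrow> x' < p \<Longrightarrow> y' < q \<Longrightarrow> g x' y' \<le> g x y"
    and nn: "\<And>x y. 0 \<le> g x y" and p: "p < 2 ^ A" and q: "q < 2 ^ A"
  shows "\<bar>\<Sum>x<p. \<Sum>y<q. g x y * e x y\<bar>
     \<le> 2 * M * real A ^ 3 * sqrt (\<Sum>x<p. \<Sum>y<q. (g x y)\<^sup>2)"
proof -
  define g' where "g' = (\<lambda>x y. if x < p \<and> y < q then g x y else 0)"
  define e' where "e' = (\<lambda>x y. if x < p \<and> y < q then e x y else 0)"
  have ext: "(\<Sum>x<2 ^ A - 1. \<Sum>y<2 ^ A - 1. if x < p \<and> y < q then f x y else 0)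
      = (\<Sum>x<p. \<Sum>y<q. f x y)" for f :: "nat \<Rightarrow> nat \<Rightarrow> real"
  proof -
    have "(\<Sum>x<2 ^ A - 1. \<Sum>y<2 ^ A - 1. if x < p \<and> y < q then f x y else 0)
      = (\<Sum>x<2 ^ A - 1. if 0 + x < p then (\<Sum>y<2 ^ A - 1. if 0 + y < q then f x y else 0) else 0)"
      by (intro sum.cong refl) auto
    also have "\<dots> = (\<Sum>x<min (2 ^ A - 1) (p - 0). \<Sum>y<min (2 ^ A - 1) (q - 0). f x y)"
      by (simp only: sum_lessThan_clip)
    finally show ?thesis using p q by (simp add: min_absorb2 Suc_le_eq le_diff_conv2 del: sum.lessThan_Suc)
  qed
  have "\<bar>\<Sum>x<2 ^ A - 1. \<Sum>y<2 ^ A - 1. g' x y * e' x y\<bar>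
     \<le> 2 * M * real A ^ 3 * sqrt (\<Sum>x<2 ^ A - 1. \<Sum>y<2 ^ A - 1. (g' x y)\<^sup>2)"
  proof (rule antitone_inner_bound)
    show "rect_bounded M e'" unfolding e'_def using e M by (rule rect_bounded_extend)
    show "antitone2 g'" unfolding antitone2_def g'_def using g nn by auto
    show "0 \<le> g' x y" for x y using nn by (simp add: g'_def)
  qed
  moreover have "g' x y * e' x y = (if x < p \<and> y < q then g x y * e x y else 0)"
    "(g' x y)\<^sup>2 = (if x < p \<and> y < q then (g x y)\<^sup>2 else 0)" for x y
    by (auto simp: g'_def e'_def)
  ultimately show ?thesis by (simp only: ext)
qed

lemma sum_lessThan_reflect:
  fixes f :: "nat \<Rightarrow> 'a :: comm_monoid_add"
  shows "(\<Sum>i<n. f (n - 1 - i)) = (\<Sum>i<n. f i)"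
  using sum.nat_diff_reindex[of f n] by simp

text \<open>The negative part of an isotone function is nonnegative and antitone, and so is the positive part
after reflection of both axes.\<close>

lemma isotone_inner_bound:
  assumes e: "\<And>x y m n. x + m \<le> p \<Longrightarrow> y + n \<le> q \<Longrightarrow>
      \<bar>\<Sum>i<m. \<Sum>j<n. e (x + i) (y + j)\<bar> \<le> M * sqrt (real m * real n)"
    and M: "0 \<le> M"
    and f: "\<And>x x' y y'. x \<le> x' \<Longrightarrow> y \<le> y' \<Longrightarrow> x' < p \<Longrightarrow> y' < q \<Longrightarrow> f x y \<le> f x' y'"
    and p: "p < 2 ^ A" and q: "q < 2 ^ A"
  shows "\<bar>\<Sum>x<p. \<Sum>y<q. f x y * e x y\<bar>
     \<le> 4 * M * real A ^ 3 * sqrt (\<Sum>x<p. \<Sum>y<q. (f x y)\<^sup>2)"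
proof -
  define F where "F = sqrt (\<Sum>x<p. \<Sum>y<q. (f x y)\<^sup>2)"
  define fp where "fp = (\<lambda>x y. max (f x y) 0)"
  define fm where "fm = (\<lambda>x y. max (- f x y) 0)"
  have reflect: "(\<Sum>x<p. \<Sum>y<q. h (p - 1 - x) (q - 1 - y)) = (\<Sum>x<p. \<Sum>y<q. h x y)"
    for h :: "nat \<Rightarrow> nat \<Rightarrow> real"
    unfolding sum_lessThan_reflect[of "\<lambda>y. h (p - 1 - x) y" q for x]
    by (rule sum_lessThan_reflect)
  have minus: "\<bar>\<Sum>x<p. \<Sum>y<q. fm x y * e x y\<bar> \<le> 2 * M * real A ^ 3 * sqrt (\<Sum>x<p. \<Sum>y<q. (fm x y)\<^sup>2)"
  proof (rule antitone_inner_bound_rectangle[OF e M _ _ p q])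
    fix x x' y y' assume "x \<le> x'" "y \<le> y'" "x' < p" "y' < q"
    then have "f x y \<le> f x' y'" by (rule f)
    then show "fm x' y' \<le> fm x y" by (simp add: fm_def)
  qed (simp_all add: fm_def)
  have "\<bar>\<Sum>x<p. \<Sum>y<q. fp (p - 1 - x) (q - 1 - y) * e (p - 1 - x) (q - 1 - y)\<bar>
      \<le> 2 * M * real A ^ 3 * sqrt (\<Sum>x<p. \<Sum>y<q. (fp (p - 1 - x) (q - 1 - y))\<^sup>2)"
  proof (rule antitone_inner_bound_rectangle[OF _ M _ _ p q])
    fix x y m n assume xm: "x + m \<le> p" and yn: "y + n \<le> q"
    have "(\<Sum>i<m. \<Sum>j<n. e (p - 1 - (x + i)) (q - 1 - (y + j)))
        = (\<Sum>i<m. \<Sum>j<n. e (p - x - m + (m - 1 - i)) (q - y - n + (n - 1 - j)))"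
      using xm yn by (intro sum.cong arg_cong2[where f = e] refl) auto
    also have "\<dots> = (\<Sum>i<m. \<Sum>j<n. e (p - x - m + i) (q - y - n + j))"
      unfolding sum_lessThan_reflect[of "\<lambda>j. e (p - x - m + (m - 1 - i)) (q - y - n + j)" n for i]
      by (rule sum_lessThan_reflect)
    also have "\<bar>\<dots>\<bar> \<le> M * sqrt (real m * real n)"
      using xm yn by (intro e) auto
    finally show "\<bar>\<Sum>i<m. \<Sum>j<n. e (p - 1 - (x + i)) (q - 1 - (y + j))\<bar> \<le> M * sqrt (real m * real n)" .
  next
    fix x x' y y' assume "x \<le> x'" "y \<le> y'" "x' < p" "y' < q"
    then have "f (p - 1 - x') (q - 1 - y') \<le> f (p - 1 - x) (q - 1 - y)"
      by (intro f) auto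
    then show "fp (p - 1 - x') (q - 1 - y') \<le> fp (p - 1 - x) (q - 1 - y)"
      by (auto simp: fp_def)
  qed (auto simp: fp_def)
  then have plus: "\<bar>\<Sum>x<p. \<Sum>y<q. fp x y * e x y\<bar> \<le> 2 * M * real A ^ 3 * sqrt (\<Sum>x<p. \<Sum>y<q. (fp x y)\<^sup>2)"
    using reflect[of "\<lambda>x y. fp x y * e x y"] reflect[of "\<lambda>x y. (fp x y)\<^sup>2"] by (simp only:)
  have K: "0 \<le> 2 * M * real A ^ 3" using M by simp
  have "sqrt (\<Sum>x<p. \<Sum>y<q. (fp x y)\<^sup>2) \<le> F" "sqrt (\<Sum>x<p. \<Sum>y<q. (fm x y)\<^sup>2) \<le> F"
    unfolding F_def fp_def fm_def by (auto intro!: real_sqrt_le_mono sum_mono simp: max_def)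
  then have FF: "2 * M * real A ^ 3 * sqrt (\<Sum>x<p. \<Sum>y<q. (fp x y)\<^sup>2) \<le> 2 * M * real A ^ 3 * F"
     "2 * M * real A ^ 3 * sqrt (\<Sum>x<p. \<Sum>y<q. (fm x y)\<^sup>2) \<le> 2 * M * real A ^ 3 * F"
    by (simp_all only: mult_left_mono[OF _ K])
  have "f x y * e x y = fp x y * e x y - fm x y * e x y" for x y
    by (auto simp: fp_def fm_def max_def)
  then have "(\<Sum>x<p. \<Sum>y<q. f x y * e x y) = (\<Sum>x<p. \<Sum>y<q. fp x y * e x y) - (\<Sum>x<p. \<Sum>y<q. fm x y * e x y)"
    by (simp add: sum_subtractf)
  then show ?thesis using plus minus FF unfolding F_def by linarith
qed

section \<open>Gaussian noise: all rectangle sums at once\<close>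

abbreviation std_normal :: "real measure" where
  "std_normal \<equiv> density lborel std_normal_density"

abbreviation white_noise :: "'i set \<Rightarrow> ('i \<Rightarrow> real) measure" where
  "white_noise I \<equiv> \<Pi>\<^sub>M i\<in>I. std_normal"

lemma prob_space_std_normal: "prob_space std_normal"
  by (rule prob_space_normal_density) simp

lemma prob_space_white_noise: "prob_space (white_noise I)"
  by (intro prob_space_PiM prob_space_std_normal)

lemma distributed_sum_white_noise:
  assumes "finite Q" "Q \<noteq> {}" "Q \<subseteq> I"
  shows "distributed (white_noise I) lborel (\<lambda>\<epsilon>. \<Sum>w\<in>Q. \<epsilon> w) (normal_density 0 (sqrt (real (card Q))))"
proof -
  interpret prob_space "white_noise I" by (rule prob_space_white_noise)
  have law: "distr (white_noise I) borel (\<lambda>\<epsilon>. \<epsilon> i) = std_normal" if "i \<in> I" for i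
    using distr_PiM_component[of I "\<lambda>_. std_normal" i] that prob_space_std_normal
      distr_cong[of "white_noise I" "white_noise I" borel std_normal "\<lambda>\<epsilon>. \<epsilon> i" "\<lambda>\<epsilon>. \<epsilon> i"] by simp
  have rv: "random_variable borel (\<lambda>\<epsilon>. \<epsilon> i)" if "i \<in> I" for i
    using measurable_component_singleton[OF that, of "\<lambda>_. std_normal"]
    by (simp cong: measurable_cong_sets)
  have "distr (white_noise I) (\<Pi>\<^sub>M i\<in>I. borel) (\<lambda>x. \<lambda>i\<in>I. x i) = distr (white_noise I) (white_noise I) (\<lambda>x. x)"
    by (intro distr_cong refl sets_PiM_cong) (auto simp: space_PiM PiE_def extensional_restrict)
  also have "\<dots> = white_noise I" by (rule distr_id)
  also have "\<dots> = (\<Pi>\<^sub>M i\<in>I. distr (white_noise I) borel (\<lambda>\<epsilon>. \<epsilon> i))"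
    by (intro PiM_cong refl) (simp add: law)
  finally have "indep_vars (\<lambda>_. borel) (\<lambda>i \<epsilon>. \<epsilon> i) I"
    using assms rv by (subst indep_vars_iff_distr_eq_PiM') auto
  then have indep: "indep_vars (\<lambda>_. borel) (\<lambda>i \<epsilon>. \<epsilon> i) Q"
    using assms(3) by (rule indep_vars_subset)
  have "distributed (white_noise I) lborel (\<lambda>\<epsilon>. \<epsilon> i) (normal_density 0 1)" if "i \<in> Q" for i
  proof -
    have "i \<in> I" using that assms(3) by auto
    then show ?thesis
      using law rv[of i] distr_cong[of "white_noise I" "white_noise I" borel lborel "\<lambda>\<epsilon>. \<epsilon> i" "\<lambda>\<epsilon>. \<epsilon> i"]
      by (simp add: distributed_def cong: measurable_cong_sets)
  qed
  then have "distributed (white_noise I) lborel (\<lambda>\<epsilon>. \<Sum>i\<in>Q. \<epsilon> i) (normal_density (\<Sum>i\<in>Q. 0) (sqrt (\<Sum>i\<in>Q. 1\<^sup>2)))"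
    using assms indep by (intro sum_indep_normal) auto
  then show ?thesis by simp
qed

text \<open>The sum is centred normal with variance \<open>card Q\<close>, and \<open>exp (Z\<^sup>2 / 4)\<close> has mean \<open>sqrt 2\<close> for a standard
normal \<open>Z\<close>: multiplying the density by it gives \<open>sqrt 2\<close> times the density with doubled variance.\<close>

lemma nn_integral_exp_sum_white_noise:
  assumes "finite Q" "Q \<noteq> {}" "Q \<subseteq> I"
  shows "(\<integral>\<^sup>+ \<epsilon>. ennreal (exp ((\<Sum>w\<in>Q. \<epsilon> w)\<^sup>2 / (4 * real (card Q)))) \<partial>white_noise I) = ennreal (sqrt 2)"
proof -
  define c where "c = real (card Q)"
  have c: "0 < c" using assms by (simp add: c_def card_gt_0_iff)
  have dens: "normal_density 0 (sqrt c) x * exp (x\<^sup>2 / (4 * c)) = sqrt 2 * normal_density 0 (sqrt (2 * c)) x" for x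
  proof -
    have "exp (- (x\<^sup>2 / (2 * c))) * exp (x\<^sup>2 / (4 * c)) = exp (- (x\<^sup>2 / (4 * c)))"
      using c by (simp add: mult_exp_exp field_simps)
    then show ?thesis
      using c by (simp add: normal_density_def real_sqrt_mult field_simps)
  qed
  have "(\<integral>\<^sup>+ \<epsilon>. ennreal (exp ((\<Sum>w\<in>Q. \<epsilon> w)\<^sup>2 / (4 * c))) \<partial>white_noise I)
      = (\<integral>\<^sup>+ x. ennreal (normal_density 0 (sqrt c) x) * ennreal (exp (x\<^sup>2 / (4 * c))) \<partial>lborel)"
    using distributed_nn_integral[OF distributed_sum_white_noise[OF assms], of "\<lambda>x. ennreal (exp (x\<^sup>2 / (4 * c)))"]
    by (simp add: c_def)
  also have "\<dots> = (\<integral>\<^sup>+ x. ennreal (sqrt 2) * ennreal (normal_density 0 (sqrt (2 * c)) x) \<partial>lborel)"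
    by (intro nn_integral_cong) (simp add: ennreal_mult[symmetric] dens)
  also have "\<dots> = ennreal (sqrt 2) * (\<integral>\<^sup>+ x. ennreal (normal_density 0 (sqrt (2 * c)) x) \<partial>lborel)"
    by (intro nn_integral_cmult) simp
  also have "(\<integral>\<^sup>+ x. ennreal (normal_density 0 (sqrt (2 * c)) x) \<partial>lborel) = 1"
    using c by (subst nn_integral_eq_integral) auto
  finally show ?thesis by (simp add: c_def)
qed

text \<open>An explicit majorant of the maximum over \<open>Q\<close> in \<open>\<Q>\<close> of the squared normalised sum
\<open>(\<Sum>w\<in>Q. \<epsilon> w)\<^sup>2 / card Q\<close>. It comes from \<open>u \<le> ln K + exp u / K\<close>. Having a sum instead of a maximum makes
measurability and the expectation immediate, and with \<open>K\<close> at least the number of sets the expectation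
is of order \<open>ln K\<close>.\<close>

definition sup_sq_bound :: "'i set set \<Rightarrow> real \<Rightarrow> ('i \<Rightarrow> real) \<Rightarrow> real" where
  "sup_sq_bound \<Q> K \<epsilon> =
     4 * (ln K + (\<Sum>Q\<in>\<Q>. exp ((\<Sum>w\<in>Q. \<epsilon> w)\<^sup>2 / (4 * real (card Q)))) / K)"

lemma sup_sq_bound_nonneg: "1 \<le> K \<Longrightarrow> 0 \<le> sup_sq_bound \<Q> K \<epsilon>"
  by (simp add: sup_sq_bound_def sum_nonneg)

lemma sup_sq_bound:
  assumes "finite \<Q>" "Q \<in> \<Q>" "1 \<le> K" "finite Q" "Q \<noteq> {}"
  shows "(\<Sum>w\<in>Q. \<epsilon> w)\<^sup>2 \<le> real (card Q) * sup_sq_bound \<Q> K \<epsilon>"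
proof -
  define u where "u = (\<Sum>w\<in>Q. \<epsilon> w)\<^sup>2 / (4 * real (card Q))"
  have c: "0 < real (card Q)" using assms by (simp add: card_gt_0_iff)
  have "u - ln K \<le> exp (u - ln K)" using exp_ge_add_one_self[of "u - ln K"] by linarith
  also have "\<dots> = exp u / K" using assms(3) by (simp add: exp_diff)
  also have "exp u \<le> (\<Sum>Q\<in>\<Q>. exp ((\<Sum>w\<in>Q. \<epsilon> w)\<^sup>2 / (4 * real (card Q))))"
    unfolding u_def by (rule member_le_sum[OF assms(2)]) (auto simp: assms(1))
  finally have "4 * u \<le> sup_sq_bound \<Q> K \<epsilon>"
    using assms(3) by (simp add: sup_sq_bound_def divide_right_mono)
  then show ?thesis using c by (simp add: u_def field_simps)
qed

lemma measurable_coordinate_sum: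
  assumes "Q \<subseteq> I"
  shows "(\<lambda>\<epsilon>. \<Sum>w\<in>Q. \<epsilon> w) \<in> borel_measurable (white_noise I)"
proof (rule borel_measurable_sum)
  fix w assume "w \<in> Q"
  then have "w \<in> I" using assms by auto
  then show "(\<lambda>\<epsilon>. \<epsilon> w) \<in> borel_measurable (white_noise I)"
    using measurable_component_singleton[of w I "\<lambda>_. std_normal"] by (simp cong: measurable_cong_sets)
qed

lemma measurable_sup_sq_bound:
  assumes "\<And>Q. Q \<in> \<Q> \<Longrightarrow> Q \<subseteq> I"
  shows "sup_sq_bound \<Q> K \<in> borel_measurable (white_noise I)"
proof -
  have "(\<lambda>\<epsilon>. \<Sum>Q\<in>\<Q>. exp ((\<Sum>w\<in>Q. \<epsilon> w)\<^sup>2 / (4 * real (card Q)))) \<in> borel_measurable (white_noise I)"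
    by (intro borel_measurable_sum borel_measurable_exp[THEN measurable_compose[rotated]]
        borel_measurable_divide borel_measurable_power borel_measurable_const measurable_coordinate_sum assms)
  then show ?thesis unfolding sup_sq_bound_def[abs_def] by measurable
qed

lemma nn_integral_sup_sq_bound:
  fixes I :: "'i set" and \<Q> :: "'i set set"
  assumes fin: "finite \<Q>" "real (card \<Q>) \<le> K" and K: "1 \<le> K"
    and Q: "\<And>Q. Q \<in> \<Q> \<Longrightarrow> finite Q \<and> Q \<noteq> {} \<and> Q \<subseteq> I"
  shows "(\<integral>\<^sup>+ \<epsilon>. ennreal (sup_sq_bound \<Q> K \<epsilon>) \<partial>white_noise I) \<le> ennreal (4 * (ln K + 2))"
proof -
  interpret prob_space "white_noise I" by (rule prob_space_white_noise)
  define E :: "'i set \<Rightarrow> ('i \<Rightarrow> real) \<Rightarrow> real" where "E = (\<lambda>Q \<epsilon>. exp ((\<Sum>w\<in>Q. \<epsilon> w)\<^sup>2 / (4 * real (card Q))))"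
  have [measurable]: "E Q \<in> borel_measurable (white_noise I)" if "Q \<in> \<Q>" for Q
    unfolding E_def using Q[OF that]
    by (intro borel_measurable_exp[THEN measurable_compose[rotated]]
        borel_measurable_divide borel_measurable_power borel_measurable_const measurable_coordinate_sum) auto
  have E: "(\<integral>\<^sup>+ \<epsilon>. ennreal (E Q \<epsilon>) \<partial>white_noise I) = ennreal (sqrt 2)" if "Q \<in> \<Q>" for Q
    unfolding E_def using Q[OF that] by (intro nn_integral_exp_sum_white_noise) auto
  have "(\<integral>\<^sup>+ \<epsilon>. ennreal (sup_sq_bound \<Q> K \<epsilon>) \<partial>white_noise I)
      = (\<integral>\<^sup>+ \<epsilon>. ennreal (4 * ln K) + ennreal (4 / K) * (\<Sum>Q\<in>\<Q>. ennreal (E Q \<epsilon>)) \<partial>white_noise I)"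
    using K by (intro nn_integral_cong)
      (simp add: sup_sq_bound_def E_def sum_nonneg ennreal_plus[symmetric] ennreal_mult[symmetric] algebra_simps del: ennreal_plus)
  also have "\<dots> = ennreal (4 * ln K) + ennreal (4 / K) * (\<Sum>Q\<in>\<Q>. ennreal (sqrt 2))"
    by (simp add: nn_integral_add nn_integral_cmult nn_integral_sum E emeasure_space_1)
  also have "\<dots> = ennreal (4 * ln K + 4 / K * (real (card \<Q>) * sqrt 2))"
    using K by (simp add: ennreal_plus[symmetric] ennreal_mult[symmetric] ennreal_of_nat_eq_real_of_nat del: ennreal_plus)
  also have "\<dots> \<le> ennreal (4 * (ln K + 2))"
  proof (rule ennreal_leI)
    have "real (card \<Q>) * sqrt 2 \<le> K * 2"
      using fin(2) sqrt2_less_2 by (intro mult_mono) auto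
    then have "real (card \<Q>) * sqrt 2 / K \<le> 2" using K by (simp add: field_simps)
    then show "4 * ln K + 4 / K * (real (card \<Q>) * sqrt 2) \<le> 4 * (ln K + 2)" by simp
  qed
  finally show ?thesis .
qed

section \<open>Logarithms and rates\<close>

lemma log_plus_ge_1: "1 \<le> log_plus x"
  using ln_mono[of "exp 1" "max x (exp 1)"] by (simp add: log_plus_def)

lemma log_plus_mono: "x \<le> y \<Longrightarrow> log_plus x \<le> log_plus y"
  unfolding log_plus_def by (intro ln_mono) (auto simp: less_max_iff_disj)

lemma ln_le_log_plus: "0 < x \<Longrightarrow> ln x \<le> log_plus x"
  unfolding log_plus_def by (intro ln_mono) auto

lemma log_plus_mult_le:
  assumes "1 \<le> r"
  shows "log_plus (a * r) \<le> log_plus a + ln r"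
proof -
  have "a * r \<le> max a (exp 1) * r" using assms by (intro mult_right_mono) auto
  moreover have "exp 1 \<le> max a (exp 1) * r"
    using mult_mono[of "exp 1" "max a (exp 1)" 1 r] assms by (simp only: mult_1_right) (simp add: le_max_iff_disj)
  ultimately have "log_plus (a * r) \<le> ln (max a (exp 1) * r)"
    unfolding log_plus_def by (intro ln_mono) (auto simp: less_max_iff_disj)
  also have "\<dots> = log_plus a + ln r"
  proof -
    have "max a (exp 1) \<noteq> 0" using exp_gt_zero[of "1 :: real"] by linarith
    then show ?thesis using assms by (simp add: log_plus_def ln_mult less_max_iff_disj)
  qed
  finally show ?thesis .
qed

text \<open>With \<open>b = a * r\<close>, the logarithm grows by a factor at most \<open>1 + ln r\<close>, and \<open>1 + ln r \<le> 7 * r powr (1 / 7)\<close>.\<close>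

lemma log_plus_pow7_div_almost_decreasing:
  assumes "0 < a" "a \<le> b"
  shows "log_plus b ^ 7 / b \<le> 7 ^ 7 * (log_plus a ^ 7 / a)"
proof -
  define r where "r = b / a"
  have r: "1 \<le> r" "b = a * r" using assms by (auto simp: r_def)
  define y where "y = r powr (1 / 7)"
  have y: "0 < y" "y ^ 7 = r" "ln r = 7 * ln y" using r(1)
    by (auto simp: y_def powr_power ln_powr)
  have "1 + ln r \<le> 7 * y" using ln_le_minus_one[OF y(1)] y(3) by linarith
  moreover have "0 \<le> 1 + ln r" using r(1) by simp
  ultimately have p: "(1 + ln r) ^ 7 \<le> 7 ^ 7 * r"
    using power_mono[of "1 + ln r" "7 * y" 7] y(2) by (simp add: power_mult_distrib)
  have "log_plus b \<le> log_plus a + 1 * ln r" using log_plus_mult_le[OF r(1)] r(2) by simp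
  also have "\<dots> \<le> log_plus a + log_plus a * ln r"
    using log_plus_ge_1[of a] r(1) by (intro add_left_mono mult_right_mono) auto
  finally have "log_plus b \<le> log_plus a * (1 + ln r)" by (simp add: algebra_simps)
  then have "log_plus b ^ 7 \<le> log_plus a ^ 7 * (1 + ln r) ^ 7"
    using log_plus_ge_1[of b] by (subst power_mult_distrib[symmetric]) (intro power_mono, auto)
  also have "\<dots> \<le> log_plus a ^ 7 * (7 ^ 7 * r)"
    using p log_plus_ge_1[of a] by (intro mult_left_mono) auto
  finally show ?thesis using assms r by (simp add: field_simps)
qed

text \<open>This is how the rate arises. Here \<open>N\<close> is the number of points of a block, \<open>p\<close> the number of points in
each of its \<open>N / p\<close> two-dimensional slices, and \<open>x0 = n / k\<close> the average block size. Blocks whose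
slices have at least \<open>x0 powr (2 / d)\<close> points are charged to their own size \<open>N\<close>. For the others
\<open>N \<le> p powr (d / 2)\<close> forces \<open>N < x0\<close>, and they are charged to the average size. As \<open>N + x0\<close> sums to
\<open>2 * n\<close> over a partition into \<open>k\<close> blocks, this replaces a concavity argument, with a constant that does
not depend on \<open>d\<close>.\<close>

lemma block_rate:
  fixes d :: nat and N p x0 :: real
  assumes d: "2 \<le> d" and p: "1 \<le> p" and N: "0 \<le> N" "N\<^sup>2 \<le> p ^ d" and x0: "1 \<le> x0"
  shows "N / p * log_plus p ^ 7 \<le> 7 ^ 7 * ((N + x0) * x0 powr (- 2 / d) * log_plus x0 ^ 7)"
proof -
  define q where "q = x0 powr (2 / d)"
  have q: "1 \<le> q" "q \<le> x0" "x0 powr (- 2 / d) = 1 / q"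
    using x0 d powr_mono[of "2 / d" 1 x0] by (auto simp: q_def ge_one_powr_ge_zero powr_minus_divide)
  have L: "0 \<le> log_plus x ^ 7" "1 \<le> log_plus x ^ 7" for x
    using log_plus_ge_1[of x] by auto
  have Lm: "log_plus x ^ 7 \<le> log_plus y ^ 7" if "x \<le> y" for x y
    using log_plus_mono[OF that] log_plus_ge_1[of x] by (intro power_mono) auto
  have "N / p * log_plus p ^ 7 \<le> 7 ^ 7 * ((N + x0) / q * log_plus x0 ^ 7)"
  proof (cases "q \<le> p")
    case True
    have "log_plus p ^ 7 / p \<le> 7 ^ 7 * (log_plus q ^ 7 / q)"
      using q True by (intro log_plus_pow7_div_almost_decreasing) auto
    also have "\<dots> \<le> 7 ^ 7 * (log_plus x0 ^ 7 / q)"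
      using Lm[OF q(2)] q(1) by (simp add: divide_right_mono)
    finally have "N * (log_plus p ^ 7 / p) \<le> (N + x0) * (7 ^ 7 * (log_plus x0 ^ 7 / q))"
      using N x0 L[of p] p by (intro mult_mono) auto
    then show ?thesis by (simp add: field_simps)
  next
    case False
    \<comment> \<open>Now \<open>N \<le> p powr (d / 2)\<close> gives \<open>N / p \<le> p powr (d / 2 - 1) \<le> q powr (d / 2 - 1) = x0 / q\<close>.\<close>
    have "N = (N\<^sup>2) powr (1 / 2)" using N(1) by (simp add: powr_half_sqrt)
    also have "\<dots> \<le> (p powr d) powr (1 / 2)"
      using N p by (intro powr_mono2) (auto simp: powr_realpow)
    also have "\<dots> = p powr (d / 2 - 1) * p"
      using p by (simp add: powr_powr powr_diff)
    finally have "N / p \<le> p powr (d / 2 - 1)" using p by (simp add: field_simps)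
    also have "\<dots> \<le> q powr (d / 2 - 1)"
      using False p d by (intro powr_mono2) auto
    also have "\<dots> = x0 / q"
      using x0 d by (simp add: q_def powr_powr powr_diff diff_divide_distrib right_diff_distrib)
    finally have "N / p * log_plus p ^ 7 \<le> x0 / q * log_plus x0 ^ 7"
      using False q x0 L[of p] by (intro mult_mono Lm) auto
    also have "\<dots> \<le> (N + x0) / q * log_plus x0 ^ 7"
      using N q L[of x0] by (intro mult_right_mono divide_right_mono) auto
    also have "\<dots> \<le> 7 ^ 7 * ((N + x0) / q * log_plus x0 ^ 7)"
      using mult_right_mono[of 1 "7 ^ 7" "(N + x0) / q * log_plus x0 ^ 7"] N q x0 L[of x0] by simp
    finally show ?thesis .
  qed
  then show ?thesis unfolding q(3) by simp
qed

section \<open>Geometry of hyperrectangles\<close>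

lemma finite_attains_max:
  fixes m :: "'a \<Rightarrow> nat"
  assumes "finite D" "D \<noteq> {}"
  obtains s where "s \<in> D" "\<And>j. j \<in> D \<Longrightarrow> m j \<le> m s"
proof -
  have "Max (m ` D) \<in> m ` D" using assms by (intro Max_in) auto
  then obtain s where "s \<in> D" "Max (m ` D) = m s" by auto
  moreover have "m j \<le> Max (m ` D)" if "j \<in> D" for j using assms that by simp
  ultimately show ?thesis using that by metis
qed

text \<open>Let \<open>s\<close> carry the largest side and \<open>t\<close> the second largest. The remaining \<open>card D - 2\<close> sides are at most
\<open>m t\<close>, whose square is at most \<open>m s * m t\<close>.\<close>

lemma exists_two_long_sides:
  fixes m :: "'a \<Rightarrow> nat"
  assumes D: "finite D" "2 \<le> card D" and m: "\<And>j. j \<in> D \<Longrightarrow> 1 \<le> m j"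
  shows "\<exists>s\<in>D. \<exists>t\<in>D. s \<noteq> t \<and> (\<Prod>j\<in>D. m j)\<^sup>2 \<le> (m s * m t) ^ card D"
proof -
  have "D \<noteq> {}" using D by auto
  with D(1) obtain s where s: "s \<in> D" "\<And>j. j \<in> D \<Longrightarrow> m j \<le> m s"
    by (rule finite_attains_max[where m = m]) blast
  have "card (D - {s}) = card D - 1" using s(1) D(1) by simp
  then have "D - {s} \<noteq> {}" using D by (metis One_nat_def Suc_1 card.empty diff_is_0_eq not_less_eq_eq)
  with finite_Diff[OF D(1)] obtain t where t: "t \<in> D - {s}" "\<And>j. j \<in> D - {s} \<Longrightarrow> m j \<le> m t"
    by (rule finite_attains_max[where m = m]) blast
  define P where "P = m s * m t"
  have card: "card (D - {s, t}) = card D - 2" using s(1) t(1) D(1) by (auto simp: card_Diff_subset)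
  have "(\<Prod>j\<in>D. m j) = P * (\<Prod>j\<in>D - {s, t}. m j)"
    using prod.remove[OF D(1) s(1), of m] prod.remove[OF finite_Diff[OF D(1)] t(1), of m]
    by (simp add: P_def mult.assoc Diff_insert2[symmetric] insert_commute)
  also have "\<dots> \<le> P * m t ^ (card D - 2)"
    unfolding card[symmetric] using t m[of t] by (intro mult_left_mono prod_le_power) auto
  finally have "(\<Prod>j\<in>D. m j)\<^sup>2 \<le> (P * m t ^ (card D - 2))\<^sup>2" by (rule power_mono) simp
  also have "\<dots> = P\<^sup>2 * (m t * m t) ^ (card D - 2)"
    by (simp add: power2_eq_square power_mult_distrib ac_simps)
  also have "\<dots> \<le> P\<^sup>2 * P ^ (card D - 2)"
    unfolding P_def using s(2)[of t] t(1) by (intro mult_left_mono power_mono mult_right_mono) auto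
  also have "\<dots> = P ^ (2 + (card D - 2))" by (rule power_add[symmetric])
  also have "2 + (card D - 2) = card D" using D(2) by (rule le_add_diff_inverse)
  finally have "s \<noteq> t \<and> (\<Prod>j\<in>D. m j)\<^sup>2 \<le> (m s * m t) ^ card D"
    using t(1) by (auto simp: P_def)
  then show ?thesis using s(1) t(1) by (intro bexI[of _ s] bexI[of _ t]) simp_all
qed

lemma sum_PiE_insert:
  fixes f :: "('a \<Rightarrow> 'b) \<Rightarrow> 'c :: comm_monoid_add"
  assumes "i \<notin> J"
  shows "(\<Sum>u\<in>Pi\<^sub>E (insert i J) B. f u) = (\<Sum>x\<in>B i. \<Sum>z\<in>Pi\<^sub>E J B. f (z(i := x)))"
proof -
  have "(\<Sum>u\<in>Pi\<^sub>E (insert i J) B. f u) = (\<Sum>(x, z)\<in>B i \<times> Pi\<^sub>E J B. f (z(i := x)))"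
    unfolding PiE_insert_eq using inj_combinator[OF assms, of B]
    by (subst sum.reindex) (auto intro!: sum.cong)
  then show ?thesis by (simp add: sum.cartesian_product)
qed

lemma hyperrectangle_eq_PiE:
  assumes "hyperrectangle d n1 R" "R \<noteq> {}"
  shows "\<exists>lo m. (\<forall>j\<in>{1..d}. 1 \<le> m j) \<and> R = (\<Pi>\<^sub>E j\<in>{1..d}. {lo j..<lo j + m j})"
proof -
  obtain I where I: "\<And>j. j \<in> {1..d} \<Longrightarrow> is_interval (I j)"
    and R: "R = {u \<in> grid d n1. \<forall>j\<in>{1..d}. real (u j) \<in> I j}"
    using assms(1) unfolding hyperrectangle_def by blast
  define J where "J = (\<lambda>j. {x \<in> {1..n1}. real x \<in> I j})"
  have RJ: "R = (\<Pi>\<^sub>E j\<in>{1..d}. J j)"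
    unfolding R J_def grid_def by (auto simp: PiE_iff extensional_def)
  have "J j \<noteq> {}" if "j \<in> {1..d}" for j
    using assms(2) that unfolding RJ by (auto simp: PiE_eq_empty_iff)
  moreover have fin: "finite (J j)" for j by (simp add: J_def)
  ultimately have minmax: "Min (J j) \<in> J j" "Max (J j) \<in> J j" if "j \<in> {1..d}" for j
    using that by auto
  have J: "J j = {Min (J j)..<Min (J j) + (Suc (Max (J j)) - Min (J j))}" if j: "j \<in> {1..d}" for j
  proof -
    have "Min (J j) \<le> Max (J j)" using minmax[OF j] fin by simp
    moreover have "x \<in> J j" if "Min (J j) \<le> x" "x \<le> Max (J j)" for x
      using minmax[OF j] that I[OF j] mem_is_interval_1_I[of "I j" "real (Min (J j))" "real (Max (J j))" "real x"]
      by (auto simp: J_def)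
    moreover have "Min (J j) \<le> x" "x \<le> Max (J j)" if "x \<in> J j" for x
      using that fin by auto
    ultimately have "J j = {Min (J j)..Max (J j)}" by (intro set_eqI) (meson atLeastAtMost_iff)
    moreover have "{Min (J j)..Max (J j)} = {Min (J j)..<Min (J j) + (Suc (Max (J j)) - Min (J j))}"
      using \<open>Min (J j) \<le> Max (J j)\<close> by (simp add: atLeastLessThanSuc_atLeastAtMost)
    ultimately show ?thesis by (rule trans)
  qed
  define lo where "lo = (\<lambda>j. Min (J j))"
  define m where "m = (\<lambda>j. Suc (Max (J j)) - Min (J j))"
  have m: "\<forall>j\<in>{1..d}. 1 \<le> m j"
  proof
    fix j assume "j \<in> {1..d}"
    then have "Min (J j) \<le> Max (J j)" using minmax fin by (intro Min_le)
    then show "1 \<le> m j" by (simp add: m_def)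
  qed
  have "R = (\<Pi>\<^sub>E j\<in>{1..d}. {lo j..<lo j + m j})"
    unfolding RJ m_def lo_def by (rule PiE_cong) (rule J)
  then show ?thesis
    using m by (intro exI[of _ lo] exI[of _ m]) (rule conjI)
qed

section \<open>Noise against isotone functions on slices and blocks\<close>

text \<open>Completing the square in the bound of \<open>isotone_inner_bound\<close>, with \<open>M\<^sup>2\<close> the majorant \<open>sup_sq_bound\<close> over
the family of all subrectangles, makes the bound uniform over all isotone \<open>f\<close>: writing \<open>F\<close> for the
norm of \<open>f\<close>, \<open>2 * c * F - F\<^sup>2 \<le> c\<^sup>2\<close>. The seven logarithms are the six in \<open>c\<^sup>2\<close>, where \<open>c\<close> is proportional
to \<open>A ^ 3\<close>, and one from the expectation of the majorant.\<close>

lemma white_noise_slice: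
  fixes \<phi> :: "nat \<Rightarrow> nat \<Rightarrow> 'i"
  assumes p: "1 \<le> p" and q: "1 \<le> q"
    and inj: "inj_on (\<lambda>(x, y). \<phi> x y) ({..<p} \<times> {..<q})"
    and mem: "\<And>x y. x < p \<Longrightarrow> y < q \<Longrightarrow> \<phi> x y \<in> I"
  shows "\<exists>\<psi>\<in>borel_measurable (white_noise I). (\<forall>\<epsilon>. 0 \<le> \<psi> \<epsilon>) \<and>
      (\<integral>\<^sup>+ \<epsilon>. ennreal (\<psi> \<epsilon>) \<partial>white_noise I) \<le> ennreal (2 ^ 18 * log_plus (real (p * q)) ^ 7) \<and>
      (\<forall>\<epsilon> f. (\<forall>x x' y y'. x \<le> x' \<longrightarrow> y \<le> y' \<longrightarrow> x' < p \<longrightarrow> y' < q \<longrightarrow> f x y \<le> f x' y') \<longrightarrow>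
         2 * (\<Sum>x<p. \<Sum>y<q. f x y * \<epsilon> (\<phi> x y)) - (\<Sum>x<p. \<Sum>y<q. (f x y)\<^sup>2) \<le> \<psi> \<epsilon>)"
proof -
  define L where "L = log_plus (real (p * q))"
  \<comment> \<open>\<open>K\<close> bounds the number of subrectangles, and \<open>A\<close> is chosen so that both sides are below \<open>2 ^ A\<close>.\<close>
  define K where "K = (real (p * q))\<^sup>2"
  define T where "T = {(x, m, y, n). x + m \<le> p \<and> y + n \<le> q \<and> 1 \<le> m \<and> 1 \<le> n}"
  define rect where "rect = (\<lambda>(x, m, y, n). (\<lambda>(i, j). \<phi> (x + i) (y + j)) ` ({..<m} \<times> {..<n}))"
  define A where "A = Suc (nat \<lfloor>log 2 (real (p * q))\<rfloor>)"
  have pq: "1 \<le> real (p * q)"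
    using p q by (metis One_nat_def mult_le_mono nat_mult_1 of_nat_1 of_nat_mono)
  have K: "1 \<le> K" using pq unfolding K_def by simp
  have L: "1 \<le> L" unfolding L_def by (rule log_plus_ge_1)
  have lnpq: "ln (real (p * q)) \<le> L" unfolding L_def using pq by (intro ln_le_log_plus) simp
  have logpq: "0 \<le> log 2 (real (p * q))" using pq by simp
  have A: "real A \<le> 3 * L"
  proof -
    have "real A \<le> 1 + log 2 (real (p * q))"
      unfolding A_def using logpq of_int_floor_le[of "log 2 (real (p * q))"] by simp
    also have "log 2 (real (p * q)) \<le> ln (real (p * q)) / (1 / 2)"
      unfolding log_def using pq ln2_ge_two_thirds by (intro divide_left_mono) auto
    finally show ?thesis using L lnpq by simp
  qed
  have pA: "p < 2 ^ A" and qA: "q < 2 ^ A"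
  proof -
    have "log 2 (real (p * q)) < real A" unfolding A_def using logpq by linarith
    then have "real (p * q) < 2 powr real A" using pq by (subst (asm) log_less_iff) auto
    then have "real (p * q) < real (2 ^ A)" by (simp add: powr_realpow)
    then have "p * q < 2 ^ A" by (simp only: of_nat_less_iff)
    moreover have "p \<le> p * q" "q \<le> p * q" using p q by simp_all
    ultimately show "p < 2 ^ A" "q < 2 ^ A" by (meson le_less_trans)+
  qed
  have inj': "inj_on (\<lambda>(i, j). \<phi> (x + i) (y + j)) ({..<m} \<times> {..<n})"
    if "x + m \<le> p" "y + n \<le> q" for x m y n
  proof (rule inj_onI, clarify)
    fix i j i' j' assume a: "i < m" "j < n" "i' < m" "j' < n" "\<phi> (x + i) (y + j) = \<phi> (x + i') (y + j')"
    then show "i = i' \<and> j = j'"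
      using inj_onD[OF inj, of "(x + i, y + j)" "(x + i', y + j')"] that by auto
  qed
  have rect: "finite (rect (x, m, y, n))" "rect (x, m, y, n) \<noteq> {}" "rect (x, m, y, n) \<subseteq> I"
    "card (rect (x, m, y, n)) = m * n"
    "(\<Sum>w\<in>rect (x, m, y, n). \<epsilon> w) = (\<Sum>i<m. \<Sum>j<n. \<epsilon> (\<phi> (x + i) (y + j)))"
    if "(x, m, y, n) \<in> T" for x m y n and \<epsilon> :: "'i \<Rightarrow> real"
  proof -
    have T: "x + m \<le> p" "y + n \<le> q" "1 \<le> m" "1 \<le> n" using that by (auto simp: T_def)
    show "finite (rect (x, m, y, n))" by (simp add: rect_def)
    show "rect (x, m, y, n) \<noteq> {}" using T by (auto simp: rect_def lessThan_empty_iff)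
    show "rect (x, m, y, n) \<subseteq> I" using T by (auto simp: rect_def intro!: mem)
    show "card (rect (x, m, y, n)) = m * n"
      by (simp add: rect_def card_image[OF inj'[OF T(1,2)]])
    show "(\<Sum>w\<in>rect (x, m, y, n). \<epsilon> w) = (\<Sum>i<m. \<Sum>j<n. \<epsilon> (\<phi> (x + i) (y + j)))"
      unfolding rect_def prod.case sum.reindex[OF inj'[OF T(1,2)]]
      by (simp add: sum.cartesian_product split_def)
  qed
  have rectQ: "finite Q \<and> Q \<noteq> {} \<and> Q \<subseteq> I" if "Q \<in> rect ` T" for Q
  proof -
    from that obtain \<tau> where \<tau>: "Q = rect \<tau>" "\<tau> \<in> T" by (rule imageE)
    obtain x m y n where "\<tau> = (x, m, y, n)" by (cases \<tau>)
    with \<tau> have "(x, m, y, n) \<in> T" "Q = rect (x, m, y, n)" by simp_all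
    then show ?thesis using rect(1-3) by simp
  qed
  have Tsub: "T \<subseteq> {..<p} \<times> {1..p} \<times> {..<q} \<times> {1..q}" by (auto simp: T_def)
  then have finT: "finite T" by (rule finite_subset) simp
  have "card (rect ` T) \<le> card ({..<p} \<times> {1..p} \<times> {..<q} \<times> {1..q})"
    using card_image_le[OF finT, of rect] card_mono[OF _ Tsub] by simp
  also have "\<dots> = (p * q)\<^sup>2" by (simp add: power2_eq_square)
  finally have card: "real (card (rect ` T)) \<le> K" unfolding K_def by (metis of_nat_le_iff of_nat_power)
  define B where "B = sup_sq_bound (rect ` T) K"
  define \<psi> where "\<psi> = (\<lambda>\<epsilon>. 16 * real A ^ 6 * B \<epsilon>)"
  have B0: "0 \<le> B \<epsilon>" for \<epsilon> unfolding B_def using K by (rule sup_sq_bound_nonneg)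
  have [measurable]: "B \<in> borel_measurable (white_noise I)"
    unfolding B_def using rectQ by (intro measurable_sup_sq_bound) blast
  have "(\<integral>\<^sup>+ \<epsilon>. ennreal (B \<epsilon>) \<partial>white_noise I) \<le> ennreal (4 * (ln K + 2))"
    unfolding B_def using finT card K rectQ by (intro nn_integral_sup_sq_bound) simp_all
  also have "\<dots> \<le> ennreal (16 * L)"
    using lnpq L pq by (intro ennreal_leI) (simp add: K_def ln_realpow)
  finally have intB: "(\<integral>\<^sup>+ \<epsilon>. ennreal (B \<epsilon>) \<partial>white_noise I) \<le> ennreal (16 * L)" .
  have "(\<integral>\<^sup>+ \<epsilon>. ennreal (\<psi> \<epsilon>) \<partial>white_noise I)
      = ennreal (16 * real A ^ 6) * (\<integral>\<^sup>+ \<epsilon>. ennreal (B \<epsilon>) \<partial>white_noise I)"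
    unfolding \<psi>_def by (subst nn_integral_cmult[symmetric]) (simp_all add: ennreal_mult B0)
  also have "\<dots> \<le> ennreal (16 * real A ^ 6) * ennreal (16 * L)"
    by (intro mult_left_mono intB) simp
  also have "\<dots> = ennreal (16 * real A ^ 6 * (16 * L))" using L by (intro ennreal_mult[symmetric]) auto
  also have "\<dots> \<le> ennreal (2 ^ 18 * L ^ 7)"
  proof (rule ennreal_leI)
    have "16 * real A ^ 6 * (16 * L) \<le> 16 * (3 * L) ^ 6 * (16 * L)"
      using A L by (intro mult_right_mono mult_left_mono power_mono) auto
    also have "\<dots> = 186624 * L ^ 7" by (simp add: power_mult_distrib eval_nat_numeral)
    also have "\<dots> \<le> 2 ^ 18 * L ^ 7" using L by (intro mult_right_mono) auto
    finally show "16 * real A ^ 6 * (16 * L) \<le> 2 ^ 18 * L ^ 7" .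
  qed
  finally have int: "(\<integral>\<^sup>+ \<epsilon>. ennreal (\<psi> \<epsilon>) \<partial>white_noise I) \<le> ennreal (2 ^ 18 * L ^ 7)" .
  have path: "2 * (\<Sum>x<p. \<Sum>y<q. f x y * \<epsilon> (\<phi> x y)) - (\<Sum>x<p. \<Sum>y<q. (f x y)\<^sup>2) \<le> \<psi> \<epsilon>"
    if f: "\<forall>x x' y y'. x \<le> x' \<longrightarrow> y \<le> y' \<longrightarrow> x' < p \<longrightarrow> y' < q \<longrightarrow> f x y \<le> f x' y'" for \<epsilon> f
  proof -
    define F where "F = sqrt (\<Sum>x<p. \<Sum>y<q. (f x y)\<^sup>2)"
    define c where "c = 4 * sqrt (B \<epsilon>) * real A ^ 3"
    have "\<bar>\<Sum>x<p. \<Sum>y<q. f x y * \<epsilon> (\<phi> x y)\<bar> \<le> c * F"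
      unfolding c_def F_def
    proof (rule isotone_inner_bound[OF _ _ _ pA qA])
      fix x y m n assume xy: "x + m \<le> p" "y + n \<le> q"
      show "\<bar>\<Sum>i<m. \<Sum>j<n. \<epsilon> (\<phi> (x + i) (y + j))\<bar> \<le> sqrt (B \<epsilon>) * sqrt (real m * real n)"
      proof (cases "m = 0 \<or> n = 0")
        case False
        then have t: "(x, m, y, n) \<in> T" using xy by (auto simp: T_def)
        have "(\<Sum>w\<in>rect (x, m, y, n). \<epsilon> w)\<^sup>2 \<le> real (card (rect (x, m, y, n))) * B \<epsilon>"
          unfolding B_def using finT t K rect(1,2)[OF t] by (intro sup_sq_bound) auto
        then have "(\<Sum>i<m. \<Sum>j<n. \<epsilon> (\<phi> (x + i) (y + j)))\<^sup>2 \<le> real (m * n) * B \<epsilon>"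
          unfolding rect(4,5)[OF t] .
        then have "sqrt ((\<Sum>i<m. \<Sum>j<n. \<epsilon> (\<phi> (x + i) (y + j)))\<^sup>2) \<le> sqrt (real (m * n) * B \<epsilon>)"
          by (rule real_sqrt_le_mono)
        then show ?thesis by (simp add: real_sqrt_mult mult.commute)
      qed auto
    qed (use f B0 in auto)
    then have "2 * (\<Sum>x<p. \<Sum>y<q. f x y * \<epsilon> (\<phi> x y)) - F\<^sup>2 \<le> 2 * (c * F) - F\<^sup>2" by linarith
    also have "\<dots> \<le> c\<^sup>2" using zero_le_power2[of "c - F"] by (simp add: power2_diff)
    also have "c\<^sup>2 = \<psi> \<epsilon>"
      using B0 by (simp add: c_def \<psi>_def power_mult_distrib flip: power_mult)
    finally show ?thesis unfolding F_def by (simp add: sum_nonneg)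
  qed
  show ?thesis
  proof (intro bexI conjI allI impI)
    show "\<psi> \<in> borel_measurable (white_noise I)" unfolding \<psi>_def by measurable
    show "0 \<le> \<psi> \<epsilon>" for \<epsilon> using B0 by (simp add: \<psi>_def)
  qed (use int path in \<open>simp_all only: L_def\<close>)
qed

lemma sum_interval_shift:
  fixes f :: "nat \<Rightarrow> 'a :: comm_monoid_add"
  shows "(\<Sum>x\<in>{l..<l + m}. f x) = (\<Sum>i<m. f (l + i))"
  using sum.shift_bounds_nat_ivl[of f 0 l m] by (simp add: atLeast0LessThan add.commute)

text \<open>The block is cut into two-dimensional slices along its two longest sides. An isotone function on the
block is isotone on every slice, so the bounds for the slices add up. Forgetting the order between
different slices loses nothing at the level of the rate.\<close>

lemma noise_block:
  fixes d n1 :: nat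
  assumes R: "hyperrectangle d n1 R" "R \<noteq> {}" and d: "2 \<le> d" and x0: "1 \<le> x0"
  shows "\<exists>\<psi>\<in>borel_measurable (noise d n1). (\<forall>\<epsilon>. 0 \<le> \<psi> \<epsilon>) \<and>
      (\<integral>\<^sup>+ \<epsilon>. ennreal (\<psi> \<epsilon>) \<partial>noise d n1)
        \<le> ennreal (2 ^ 18 * 7 ^ 7 * ((real (card R) + x0) * x0 powr (- 2 / real d) * log_plus x0 ^ 7)) \<and>
      (\<forall>\<epsilon> v. mono_on R v \<longrightarrow> 2 * (\<Sum>w\<in>R. v w * \<epsilon> w) - (\<Sum>w\<in>R. (v w)\<^sup>2) \<le> \<psi> \<epsilon>)"
proof -
  define W where "W = white_noise (grid d n1)"
  have W: "noise d n1 = W" by (simp add: noise_def W_def)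
  define D where "D = {1..d}"
  from hyperrectangle_eq_PiE[OF R] obtain lo m where m': "\<forall>j\<in>D. 1 \<le> m j"
    and RB: "R = (\<Pi>\<^sub>E j\<in>D. {lo j..<lo j + m j})"
    unfolding D_def by (elim exE conjE)
  have m: "1 \<le> m j" if "j \<in> D" for j using m' that by (rule bspec)
  have fD: "finite D" "card D = d" by (auto simp: D_def)
  obtain s t where st: "s \<in> D" "t \<in> D" "s \<noteq> t" "(\<Prod>j\<in>D. m j)\<^sup>2 \<le> (m s * m t) ^ d"
    using exists_two_long_sides[of D m] fD d m by auto
  define Bx where "Bx = (\<lambda>j. {lo j..<lo j + m j})"
  define Z where "Z = Pi\<^sub>E (D - {s, t}) Bx"
  \<comment> \<open>Fixing the coordinates other than \<open>s\<close> and \<open>t\<close> to \<open>z\<close> selects a slice, which \<open>\<phi> z\<close> parametrises from the origin.\<close>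
  define \<phi> where "\<phi> = (\<lambda>z x y. z(t := lo t + y, s := lo s + x) :: nat \<Rightarrow> nat)"
  have D: "D = insert s (insert t (D - {s, t}))" using st by auto
  have fZ: "finite Z" unfolding Z_def Bx_def using fD by (intro finite_PiE) auto
  have sumR: "(\<Sum>w\<in>R. f w) = (\<Sum>z\<in>Z. \<Sum>x<m s. \<Sum>y<m t. f (\<phi> z x y))"
    for f :: "(nat \<Rightarrow> nat) \<Rightarrow> real"
  proof -
    have "(\<Sum>w\<in>R. f w) = (\<Sum>x\<in>Bx s. \<Sum>y\<in>Bx t. \<Sum>z\<in>Z. f (z(t := y, s := x)))"
      unfolding RB Bx_def[symmetric] using st(3)
      by (subst D) (simp add: sum_PiE_insert Z_def)
    also have "\<dots> = (\<Sum>x<m s. \<Sum>y<m t. \<Sum>z\<in>Z. f (\<phi> z x y))"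
      by (simp add: Bx_def sum_interval_shift \<phi>_def)
    also have "\<dots> = (\<Sum>x<m s. \<Sum>z\<in>Z. \<Sum>y<m t. f (\<phi> z x y))"
      by (intro sum.cong refl sum.swap)
    also have "\<dots> = (\<Sum>z\<in>Z. \<Sum>x<m s. \<Sum>y<m t. f (\<phi> z x y))"
      by (rule sum.swap)
    finally show ?thesis .
  qed
  have \<phi>R: "\<phi> z x y \<in> R" if "z \<in> Z" "x < m s" "y < m t" for z x y
  proof -
    have xy: "lo s + x \<in> Bx s" "lo t + y \<in> Bx t" using that by (auto simp: Bx_def)
    have "z(t := lo t + y, s := lo s + x) \<in> Pi\<^sub>E (insert s (insert t (D - {s, t}))) Bx"
      using that(1) unfolding Z_def by (intro PiE_fun_upd xy)
    then show ?thesis unfolding RB Bx_def[symmetric] \<phi>_def D[symmetric] .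
  qed
  have Rgrid: "R \<subseteq> grid d n1" using R(1) by (auto simp: hyperrectangle_def)
  define p where "p = real (m s * m t)"
  have p: "1 \<le> p"
    using m[OF st(1)] m[OF st(2)] unfolding p_def
    by (metis One_nat_def mult_le_mono nat_mult_1 of_nat_1 of_nat_mono)
  define majorizes where "majorizes = (\<lambda>z \<psi>. \<psi> \<in> borel_measurable W \<and> (\<forall>\<epsilon>. 0 \<le> \<psi> \<epsilon>) \<and>
      (\<integral>\<^sup>+ \<epsilon>. ennreal (\<psi> \<epsilon>) \<partial>W) \<le> ennreal (2 ^ 18 * log_plus p ^ 7) \<and>
      (\<forall>\<epsilon> f. (\<forall>x x' y y'. x \<le> x' \<longrightarrow> y \<le> y' \<longrightarrow> x' < m s \<longrightarrow> y' < m t \<longrightarrow> f x y \<le> f x' y') \<longrightarrow>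
         2 * (\<Sum>x<m s. \<Sum>y<m t. f x y * \<epsilon> (\<phi> z x y)) - (\<Sum>x<m s. \<Sum>y<m t. (f x y)\<^sup>2) \<le> \<psi> \<epsilon>))"
  have "\<exists>\<psi>. majorizes z \<psi>" if z: "z \<in> Z" for z
    unfolding majorizes_def Bex_def[symmetric]
    unfolding p_def W_def
  proof (rule white_noise_slice)
    show "inj_on (\<lambda>(x, y). \<phi> z x y) ({..<m s} \<times> {..<m t})"
    proof (rule inj_onI, clarify)
      fix x y x' y' assume "\<phi> z x y = \<phi> z x' y'"
      then have "\<phi> z x y s = \<phi> z x' y' s" "\<phi> z x y t = \<phi> z x' y' t" by simp_all
      then show "x = x' \<and> y = y'" using st(3) by (simp add: \<phi>_def)
    qed
  qed (use m st z \<phi>R Rgrid in auto)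
  then obtain \<psi> where "\<And>z. z \<in> Z \<Longrightarrow> majorizes z (\<psi> z)"
    using bchoice[of Z majorizes] by auto
  then have \<psi>: "\<And>z. z \<in> Z \<Longrightarrow> \<psi> z \<in> borel_measurable W"
      "\<And>z \<epsilon>. z \<in> Z \<Longrightarrow> 0 \<le> \<psi> z \<epsilon>"
      "\<And>z. z \<in> Z \<Longrightarrow> (\<integral>\<^sup>+ \<epsilon>. ennreal (\<psi> z \<epsilon>) \<partial>W) \<le> ennreal (2 ^ 18 * log_plus p ^ 7)"
      "\<And>z \<epsilon> f. z \<in> Z \<Longrightarrow>
         \<forall>x x' y y'. x \<le> x' \<longrightarrow> y \<le> y' \<longrightarrow> x' < m s \<longrightarrow> y' < m t \<longrightarrow> f x y \<le> f x' y' \<Longrightarrow>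
         2 * (\<Sum>x<m s. \<Sum>y<m t. f x y * \<epsilon> (\<phi> z x y)) - (\<Sum>x<m s. \<Sum>y<m t. (f x y)\<^sup>2) \<le> \<psi> z \<epsilon>"
    unfolding majorizes_def by blast+
  define N where "N = real (card R)"
  have cardR: "card R = (\<Prod>j\<in>D. m j)" unfolding RB using fD by (simp add: card_PiE)
  have cardZ: "real (card Z) = N / p"
  proof -
    have "N = (\<Sum>w\<in>R. 1)" by (simp add: N_def)
    also have "\<dots> = real (card Z) * p" unfolding sumR p_def by simp
    finally show ?thesis using p by (simp add: field_simps)
  qed
  have "real ((\<Prod>j\<in>D. m j)\<^sup>2) \<le> real ((m s * m t) ^ d)" using st(4) by (simp only: of_nat_le_iff)
  then have "N\<^sup>2 \<le> p ^ d" unfolding N_def cardR p_def by (simp only: of_nat_power)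
  then have rate: "N / p * log_plus p ^ 7 \<le> 7 ^ 7 * ((N + x0) * x0 powr (- 2 / real d) * log_plus x0 ^ 7)"
    using d p x0 by (intro block_rate) (auto simp: N_def)
  have "(\<integral>\<^sup>+ \<epsilon>. ennreal (\<Sum>z\<in>Z. \<psi> z \<epsilon>) \<partial>W) = (\<integral>\<^sup>+ \<epsilon>. (\<Sum>z\<in>Z. ennreal (\<psi> z \<epsilon>)) \<partial>W)"
    using \<psi>(2) by (simp add: sum_ennreal)
  also have "\<dots> = (\<Sum>z\<in>Z. \<integral>\<^sup>+ \<epsilon>. ennreal (\<psi> z \<epsilon>) \<partial>W)"
    using \<psi>(1) by (intro nn_integral_sum) auto
  also have "\<dots> \<le> (\<Sum>z\<in>Z. ennreal (2 ^ 18 * log_plus p ^ 7))"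
    by (intro sum_mono \<psi>(3))
  also have "\<dots> = ennreal (real (card Z) * (2 ^ 18 * log_plus p ^ 7))"
    using log_plus_ge_1[of p] by (simp add: ennreal_mult ennreal_of_nat_eq_real_of_nat)
  also have "\<dots> \<le> ennreal (2 ^ 18 * 7 ^ 7 * ((N + x0) * x0 powr (- 2 / real d) * log_plus x0 ^ 7))"
  proof (rule ennreal_leI)
    have "2 ^ 18 * (N / p * log_plus p ^ 7) \<le> 2 ^ 18 * (7 ^ 7 * ((N + x0) * x0 powr (- 2 / real d) * log_plus x0 ^ 7))"
      by (rule mult_left_mono[OF rate]) simp
    then show "real (card Z) * (2 ^ 18 * log_plus p ^ 7)
        \<le> 2 ^ 18 * 7 ^ 7 * ((N + x0) * x0 powr (- 2 / real d) * log_plus x0 ^ 7)"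
      unfolding cardZ by (simp only: mult_ac)
  qed
  finally have int: "(\<integral>\<^sup>+ \<epsilon>. ennreal (\<Sum>z\<in>Z. \<psi> z \<epsilon>) \<partial>W)
      \<le> ennreal (2 ^ 18 * 7 ^ 7 * ((N + x0) * x0 powr (- 2 / real d) * log_plus x0 ^ 7))" .
  have path: "2 * (\<Sum>w\<in>R. v w * \<epsilon> w) - (\<Sum>w\<in>R. (v w)\<^sup>2) \<le> (\<Sum>z\<in>Z. \<psi> z \<epsilon>)"
    if v: "mono_on R v" for \<epsilon> v
  proof -
    have "2 * (\<Sum>w\<in>R. v w * \<epsilon> w) - (\<Sum>w\<in>R. (v w)\<^sup>2)
       = (\<Sum>z\<in>Z. 2 * (\<Sum>x<m s. \<Sum>y<m t. v (\<phi> z x y) * \<epsilon> (\<phi> z x y)) - (\<Sum>x<m s. \<Sum>y<m t. (v (\<phi> z x y))\<^sup>2))"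
      by (simp add: sumR sum_subtractf sum_distrib_left)
    also have "\<dots> \<le> (\<Sum>z\<in>Z. \<psi> z \<epsilon>)"
    proof (rule sum_mono, rule \<psi>(4))
      fix z assume z: "z \<in> Z"
      show "\<forall>x x' y y'. x \<le> x' \<longrightarrow> y \<le> y' \<longrightarrow> x' < m s \<longrightarrow> y' < m t \<longrightarrow> v (\<phi> z x y) \<le> v (\<phi> z x' y')"
      proof (intro allI impI mono_onD[OF v] \<phi>R z)
        fix x x' y y' :: nat assume "x \<le> x'" "y \<le> y'"
        then show "\<phi> z x y \<le> \<phi> z x' y'" by (auto simp: \<phi>_def le_fun_def)
      qed auto
    qed
    finally show ?thesis .
  qed
  show ?thesis
    unfolding W
  proof (intro bexI conjI allI impI)
    show "(\<lambda>\<epsilon>. \<Sum>z\<in>Z. \<psi> z \<epsilon>) \<in> borel_measurable W"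
      by (intro borel_measurable_sum \<psi>(1))
    show "0 \<le> (\<Sum>z\<in>Z. \<psi> z \<epsilon>)" for \<epsilon> by (intro sum_nonneg \<psi>(2))
  qed (use int path in \<open>simp_all only: N_def\<close>)
qed

section \<open>Least squares as projection onto a closed convex set\<close>

lemma finite_grid: "finite (grid d n1)"
  unfolding grid_def by (intro finite_PiE) auto

lemma card_grid: "card (grid d n1) = n1 ^ d"
  unfolding grid_def by (subst card_PiE) auto

lemma isotone_segment:
  assumes h: "h \<in> isotone d n1" and \<theta>: "\<theta> \<in> isotone d n1" and t: "0 \<le> t" "t \<le> 1"
  shows "(\<lambda>w. h w + t * (\<theta> w - h w)) \<in> isotone d n1"
proof -
  have "h u + t * (\<theta> u - h u) \<le> h v + t * (\<theta> v - h v)"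
    if "u \<in> grid d n1" "v \<in> grid d n1" "u \<le> v" for u v
  proof -
    have "h u \<le> h v" "\<theta> u \<le> \<theta> v" using h \<theta> that by (auto simp: isotone_def mono_on_def)
    then have "(1 - t) * h u + t * \<theta> u \<le> (1 - t) * h v + t * \<theta> v"
      using t by (intro add_mono mult_left_mono) auto
    then show ?thesis by (simp add: algebra_simps)
  qed
  moreover have "h w + t * (\<theta> w - h w) = undefined" if "w \<notin> grid d n1" for w
    using h \<theta> that by (simp add: isotone_def extensional_def)
  ultimately show ?thesis by (simp add: isotone_def extensional_def mono_on_def)
qed

lemma closed_isotone: "closed (isotone d n1)"
proof -
  have coord: "continuous_on UNIV (\<lambda>\<theta> :: (nat \<Rightarrow> nat) \<Rightarrow> real. \<theta> w)" for w
    by (rule continuous_on_product_coordinates)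
  have eq: "isotone d n1 = {\<theta>. \<forall>w. w \<notin> grid d n1 \<longrightarrow> \<theta> w = undefined} \<inter>
     {\<theta>. \<forall>u v. u \<in> grid d n1 \<and> v \<in> grid d n1 \<and> u \<le> v \<longrightarrow> \<theta> u \<le> \<theta> v}"
    by (auto simp: isotone_def extensional_def mono_on_def)
  show ?thesis
    unfolding eq
    by (intro closed_Int closed_Collect_all closed_Collect_imp open_Collect_const
        closed_Collect_eq closed_Collect_le coord continuous_on_const)
qed

text \<open>A minimiser exists: competitors at least as good as the zero function stay within distance \<open>2 * f z\<close> of zero in
every coordinate, so by Tychonoff's theorem they lie in a compact set, on which the continuous
distance attains its minimum.\<close>

lemma lse_minimizes:
  shows lse_isotone: "lse d n1 y \<in> isotone d n1"
    and lse_le: "\<theta> \<in> isotone d n1 \<Longrightarrow>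
      L2_set (\<lambda>w. y w - lse d n1 y w) (grid d n1) \<le> L2_set (\<lambda>w. y w - \<theta> w) (grid d n1)"
proof -
  define G where "G = grid d n1"
  define f where "f = (\<lambda>\<theta>. L2_set (\<lambda>w. y w - \<theta> w) G)"
  \<comment> \<open>The zero function as a point of the cone, whose elements take the default value off the grid.\<close>
  define z where "z = (\<lambda>w. if w \<in> G then 0 else undefined :: real)"
  define S where "S = (\<lambda>w. if w \<in> G then {- (2 * f z)..2 * f z} else {undefined :: real})"
  have G: "finite G" unfolding G_def by (rule finite_grid)
  have f0: "0 \<le> f \<theta>" for \<theta> by (simp add: f_def)
  have z: "z \<in> isotone d n1" by (auto simp: z_def G_def isotone_def extensional_def mono_on_def)
  have "compact (Pi\<^sub>E UNIV S)"
  proof -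
    have "compactin (product_topology (\<lambda>_. euclidean) UNIV) (Pi\<^sub>E UNIV S)"
      unfolding compactin_PiE by (auto simp: S_def)
    then show ?thesis by (simp add: euclidean_product_topology)
  qed
  then have "compact (Pi\<^sub>E UNIV S \<inter> isotone d n1)"
    by (intro compact_Int_closed closed_isotone)
  moreover have zS: "z \<in> Pi\<^sub>E UNIV S \<inter> isotone d n1"
    using z f0[of z] by (auto simp: S_def z_def)
  moreover have cont: "continuous_on A f" for A
  proof -
    have coord: "continuous_on A (\<lambda>\<theta> :: (nat \<Rightarrow> nat) \<Rightarrow> real. \<theta> w)" for w
      by (rule continuous_on_subset[OF continuous_on_product_coordinates]) simp
    show ?thesis unfolding f_def L2_set_def by (intro continuous_intros coord)
  qed
  ultimately obtain h where h: "h \<in> Pi\<^sub>E UNIV S \<inter> isotone d n1"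
    and hmin: "\<And>\<theta>. \<theta> \<in> Pi\<^sub>E UNIV S \<inter> isotone d n1 \<Longrightarrow> f h \<le> f \<theta>"
    using continuous_attains_inf[of "Pi\<^sub>E UNIV S \<inter> isotone d n1" f] by blast
  have min: "f h \<le> f \<theta>" if \<theta>: "\<theta> \<in> isotone d n1" for \<theta>
  proof (cases "f \<theta> \<le> f z")
    case True
    have "\<theta> w \<in> S w" for w
    proof (cases "w \<in> G")
      case w: True
      have "\<bar>y w\<bar> \<le> f z"
        using member_le_L2_set[OF G w, of "\<lambda>w. \<bar>y w - z w\<bar>"] w by (simp add: f_def L2_set_def z_def)
      moreover have "\<bar>y w - \<theta> w\<bar> \<le> f \<theta>"
        using member_le_L2_set[OF G w, of "\<lambda>w. \<bar>y w - \<theta> w\<bar>"] by (simp add: f_def L2_set_def)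
      ultimately have "- (2 * f z) \<le> \<theta> w" "\<theta> w \<le> 2 * f z" using True by linarith+
      then show ?thesis using w by (simp add: S_def)
    next
      case False
      then show ?thesis using \<theta> by (simp add: S_def isotone_def extensional_def G_def)
    qed
    then have "\<theta> \<in> Pi\<^sub>E UNIV S \<inter> isotone d n1" using \<theta> by (simp add: PiE_iff)
    then show ?thesis by (rule hmin)
  next
    case False
    then show ?thesis using hmin[OF zS] by simp
  qed
  have "is_arg_min f (\<lambda>\<theta>. \<theta> \<in> isotone d n1) h"
    unfolding is_arg_min_linorder using h min by (intro conjI allI impI) simp_all
  then have "is_arg_min f (\<lambda>\<theta>. \<theta> \<in> isotone d n1) (lse d n1 y)"
    unfolding lse_def arg_min_on_def arg_min_def f_def[symmetric] G_def[symmetric] 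
    by (rule someI[where P = "is_arg_min f (\<lambda>\<theta>. \<theta> \<in> isotone d n1)"])
  then have lse: "lse d n1 y \<in> isotone d n1" "\<And>\<theta>. \<theta> \<in> isotone d n1 \<Longrightarrow> f (lse d n1 y) \<le> f \<theta>"
    unfolding is_arg_min_linorder by simp_all
  show "lse d n1 y \<in> isotone d n1" by (rule lse(1))
  show "L2_set (\<lambda>w. y w - lse d n1 y w) (grid d n1) \<le> L2_set (\<lambda>w. y w - \<theta> w) (grid d n1)"
    if "\<theta> \<in> isotone d n1"
    using lse(2)[OF that] unfolding f_def G_def .
qed

lemma L2_set_power2: "(L2_set f A)\<^sup>2 = (\<Sum>w\<in>A. (f w)\<^sup>2)"
  by (simp add: L2_set_def sum_nonneg)

text \<open>Moving from the projection a small step \<open>t\<close> towards \<open>\<theta>\<close> stays in the convex set \<open>isotone d n1\<close>, and would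
decrease the distance to \<open>y\<close> if the inner product were positive.\<close>

lemma lse_obtuse_angle:
  assumes \<theta>: "\<theta> \<in> isotone d n1"
  shows "(\<Sum>w\<in>grid d n1. (y w - lse d n1 y w) * (\<theta> w - lse d n1 y w)) \<le> 0"
proof (rule ccontr)
  define h where "h = lse d n1 y"
  define c where "c = (\<Sum>w\<in>grid d n1. (y w - h w) * (\<theta> w - h w))"
  define s where "s = (\<Sum>w\<in>grid d n1. (\<theta> w - h w)\<^sup>2)"
  assume "\<not> ?thesis"
  then have c: "0 < c" by (simp add: c_def h_def)
  have s: "0 \<le> s" unfolding s_def by (simp add: sum_nonneg)
  define t where "t = min 1 (c / (s + 1))"
  have t: "0 < t" "t \<le> 1" using c s by (auto simp: t_def)
  have "t * s \<le> c / (s + 1) * s" using s by (intro mult_right_mono) (auto simp: t_def)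
  also have "\<dots> \<le> c" using c s by (simp add: field_simps)
  finally have ts: "t * s \<le> c" .
  have "L2_set (\<lambda>w. y w - h w) (grid d n1) \<le> L2_set (\<lambda>w. y w - (h w + t * (\<theta> w - h w))) (grid d n1)"
    unfolding h_def using t \<theta> by (intro lse_le isotone_segment lse_isotone) auto
  then have "(L2_set (\<lambda>w. y w - h w) (grid d n1))\<^sup>2 \<le> (L2_set (\<lambda>w. y w - (h w + t * (\<theta> w - h w))) (grid d n1))\<^sup>2"
    by (intro power_mono) auto
  also have "\<dots> = (\<Sum>w\<in>grid d n1. (y w - h w)\<^sup>2 - 2 * t * ((y w - h w) * (\<theta> w - h w)) + t\<^sup>2 * (\<theta> w - h w)\<^sup>2)"
    unfolding L2_set_power2 by (intro sum.cong refl) (simp add: power2_eq_square algebra_simps)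
  also have "\<dots> = (L2_set (\<lambda>w. y w - h w) (grid d n1))\<^sup>2 - 2 * t * c + t\<^sup>2 * s"
    unfolding L2_set_power2 c_def s_def by (simp add: sum.distrib sum_subtractf sum_distrib_left)
  finally have "t * (2 * c) \<le> t * (t * s)" by (simp add: power2_eq_square)
  then have "2 * c \<le> t * s" using t(1) by (simp only: mult_le_cancel_left_pos)
  then show False using c ts by linarith
qed

text \<open>The leading constant 1 in front of the approximation error comes from here: the surplus
\<open>(h - \<theta>)\<^sup>2\<close> that projection onto a convex set provides is kept, to absorb the noise term later.\<close>

lemma oracle_inequality:
  fixes \<epsilon> \<theta>0 :: "(nat \<Rightarrow> nat) \<Rightarrow> real"
  assumes \<theta>: "\<theta> \<in> isotone d n1"
  defines "h \<equiv> lse d n1 (\<lambda>v. \<theta>0 v + \<epsilon> v)"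
  shows "(L2_set (\<lambda>w. h w - \<theta>0 w) (grid d n1))\<^sup>2 \<le> (L2_set (\<lambda>w. \<theta> w - \<theta>0 w) (grid d n1))\<^sup>2
    + (\<Sum>w\<in>grid d n1. 2 * ((h w - \<theta> w) * \<epsilon> w) - (h w - \<theta> w)\<^sup>2)"
proof -
  have "(\<Sum>w\<in>grid d n1. (h w - \<theta>0 w)\<^sup>2) = (\<Sum>w\<in>grid d n1. (\<theta> w - \<theta>0 w)\<^sup>2
      + (2 * ((h w - \<theta> w) * \<epsilon> w) - (h w - \<theta> w)\<^sup>2) + 2 * ((\<theta>0 w + \<epsilon> w - h w) * (\<theta> w - h w)))"
    by (intro sum.cong refl) (simp add: power2_eq_square algebra_simps)
  also have "\<dots> = (\<Sum>w\<in>grid d n1. (\<theta> w - \<theta>0 w)\<^sup>2)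
      + (\<Sum>w\<in>grid d n1. 2 * ((h w - \<theta> w) * \<epsilon> w) - (h w - \<theta> w)\<^sup>2)
      + 2 * (\<Sum>w\<in>grid d n1. (\<theta>0 w + \<epsilon> w - h w) * (\<theta> w - h w))"
    by (simp add: sum.distrib sum_distrib_left)
  finally show ?thesis
    using lse_obtuse_angle[OF \<theta>, of "\<lambda>v. \<theta>0 v + \<epsilon> v"] unfolding L2_set_power2 h_def by linarith
qed

section \<open>The oracle inequality for the risk\<close>

text \<open>On a block where \<open>\<theta>\<close> is constant, the difference of the estimator and \<open>\<theta>\<close> is isotone again, so
\<open>noise_block\<close> bounds the excess term of the oracle inequality block by block.\<close>

lemma risk_le_piecewise:
  assumes d: "2 \<le> d" and n: "n = n1 ^ d" "1 \<le> n" and \<theta>: "\<theta> \<in> isotone_pieces d n1 k"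
  shows "risk d n1 \<theta>0 \<le> ennreal ((L2_set (\<lambda>w. \<theta> w - \<theta>0 w) (grid d n1))\<^sup>2 / real n)
    + ennreal (2 ^ 19 * 7 ^ 7 * (real k / real n) powr (2 / real d) * (log_plus (real n / real k)) ^ 8)"
proof -
  interpret prob_space "noise d n1"
    unfolding noise_def by (rule prob_space_white_noise)
  obtain P where P: "partition_on (grid d n1) P" "finite P" "card P = k"
    and PR: "\<And>R. R \<in> P \<Longrightarrow> hyperrectangle d n1 R" "\<And>R. R \<in> P \<Longrightarrow> \<theta> constant_on R"
    and iso: "\<theta> \<in> isotone d n1"
    using \<theta> unfolding isotone_pieces_def by blast
  have sumP: "(\<Sum>w\<in>grid d n1. f w) = (\<Sum>R\<in>P. \<Sum>w\<in>R. f w)" for f :: "(nat \<Rightarrow> nat) \<Rightarrow> real"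
    using sum.partition[OF finite_grid P(1), of f] by simp
  have PG: "R \<subseteq> grid d n1" "R \<noteq> {}" if "R \<in> P" for R
    using P(1) that by (auto simp: partition_on_def)
  have "real n = (\<Sum>w\<in>grid d n1. 1)" by (simp add: card_grid n)
  then have sum_card: "real n = (\<Sum>R\<in>P. real (card R))" unfolding sumP by simp
  have k1: "1 \<le> k"
  proof (rule ccontr)
    assume "\<not> ?thesis"
    then have "P = {}" using P(2,3) by (simp add: not_le)
    then show False using sum_card n(2) by simp
  qed
  have "real k = (\<Sum>R\<in>P. 1)" using P by simp
  also have "\<dots> \<le> (\<Sum>R\<in>P. real (card R))"
  proof (rule sum_mono)
    fix R assume "R \<in> P"
    then have "0 < card R" using PG finite_subset[OF PG(1) finite_grid] by (simp add: card_gt_0_iff)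
    then show "1 \<le> real (card R)" by simp
  qed
  finally have kn: "real k \<le> real n" using sum_card by simp
  define x where "x = real n / real k"
  have x: "1 \<le> x" using kn k1 by (simp add: x_def)
  define r where "r = x powr (- 2 / real d) * log_plus x ^ 7"
  have r0: "0 \<le> r" using log_plus_ge_1[of x] by (simp add: r_def)
  define W where "W = noise d n1"
  define majorizes where "majorizes = (\<lambda>R \<psi>. \<psi> \<in> borel_measurable W \<and> (\<forall>\<epsilon>. 0 \<le> \<psi> \<epsilon>) \<and>
      (\<integral>\<^sup>+ \<epsilon>. ennreal (\<psi> \<epsilon>) \<partial>W)
        \<le> ennreal (2 ^ 18 * 7 ^ 7 * ((real (card R) + x) * x powr (- 2 / real d) * log_plus x ^ 7)) \<and>
      (\<forall>\<epsilon> v. mono_on R v \<longrightarrow> 2 * (\<Sum>w\<in>R. v w * \<epsilon> w) - (\<Sum>w\<in>R. (v w)\<^sup>2) \<le> \<psi> \<epsilon>))"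
  have "\<exists>\<psi>. majorizes R \<psi>" if "R \<in> P" for R
    unfolding majorizes_def Bex_def[symmetric] W_def
    using PR(1)[OF that] PG(2)[OF that] d x by (rule noise_block)
  then obtain \<psi> where "\<And>R. R \<in> P \<Longrightarrow> majorizes R (\<psi> R)"
    using bchoice[of P majorizes] by auto
  then have \<psi>: "\<And>R. R \<in> P \<Longrightarrow> \<psi> R \<in> borel_measurable W"
      "\<And>R \<epsilon>. R \<in> P \<Longrightarrow> 0 \<le> \<psi> R \<epsilon>"
      "\<And>R. R \<in> P \<Longrightarrow> (\<integral>\<^sup>+ \<epsilon>. ennreal (\<psi> R \<epsilon>) \<partial>W)
         \<le> ennreal (2 ^ 18 * 7 ^ 7 * ((real (card R) + x) * x powr (- 2 / real d) * log_plus x ^ 7))"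
      "\<And>R \<epsilon> v. R \<in> P \<Longrightarrow> mono_on R v \<Longrightarrow> 2 * (\<Sum>w\<in>R. v w * \<epsilon> w) - (\<Sum>w\<in>R. (v w)\<^sup>2) \<le> \<psi> R \<epsilon>"
    unfolding majorizes_def by blast+
  define a where "a = (L2_set (\<lambda>w. \<theta> w - \<theta>0 w) (grid d n1))\<^sup>2"
  have a0: "0 \<le> a" by (simp add: a_def)
  have path: "(L2_set (\<lambda>w. lse d n1 (\<lambda>v. \<theta>0 v + \<epsilon> v) w - \<theta>0 w) (grid d n1))\<^sup>2
      \<le> a + (\<Sum>R\<in>P. \<psi> R \<epsilon>)" for \<epsilon>
  proof -
    define h where "h = lse d n1 (\<lambda>v. \<theta>0 v + \<epsilon> v)"
    have "(\<Sum>w\<in>grid d n1. 2 * ((h w - \<theta> w) * \<epsilon> w) - (h w - \<theta> w)\<^sup>2)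
        = (\<Sum>R\<in>P. 2 * (\<Sum>w\<in>R. (h w - \<theta> w) * \<epsilon> w) - (\<Sum>w\<in>R. (h w - \<theta> w)\<^sup>2))"
      unfolding sumP by (simp add: sum_subtractf sum_distrib_left)
    also have "\<dots> \<le> (\<Sum>R\<in>P. \<psi> R \<epsilon>)"
    proof (rule sum_mono, rule \<psi>(4))
      fix R assume R: "R \<in> P"
      obtain c where c: "\<And>w. w \<in> R \<Longrightarrow> \<theta> w = c" using PR(2)[OF R] by (auto simp: constant_on_def)
      have "mono_on (grid d n1) h" using lse_isotone[of d n1] by (simp add: h_def isotone_def)
      then show "mono_on R (\<lambda>w. h w - \<theta> w)" using PG(1)[OF R] c by (auto simp: mono_on_def)
    qed
    finally show ?thesis
      using oracle_inequality[OF iso, of \<theta>0 \<epsilon>] unfolding a_def h_def by linarith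
  qed
  have "risk d n1 \<theta>0 \<le> (\<integral>\<^sup>+ \<epsilon>. ennreal ((a + (\<Sum>R\<in>P. \<psi> R \<epsilon>)) / real n) \<partial>W)"
    unfolding risk_def W_def n(1)[symmetric]
    using path by (intro nn_integral_mono ennreal_leI divide_right_mono) auto
  also have "\<dots> = (\<integral>\<^sup>+ \<epsilon>. ennreal (a / real n) + ennreal (1 / real n) * (\<Sum>R\<in>P. ennreal (\<psi> R \<epsilon>)) \<partial>W)"
    using \<psi>(2) a0 by (intro nn_integral_cong)
      (simp add: sum_nonneg add_divide_distrib ennreal_plus ennreal_mult[symmetric])
  also have "\<dots> = ennreal (a / real n) + ennreal (1 / real n) * (\<Sum>R\<in>P. \<integral>\<^sup>+ \<epsilon>. ennreal (\<psi> R \<epsilon>) \<partial>W)"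
    using \<psi>(1) emeasure_space_1 
    by (simp add: nn_integral_add nn_integral_cmult nn_integral_sum W_def)
  also have "\<dots> \<le> ennreal (a / real n) + ennreal (1 / real n) * (\<Sum>R\<in>P. ennreal (2 ^ 18 * 7 ^ 7 * r * (real (card R) + x)))"
  proof (intro add_left_mono mult_left_mono sum_mono)
    fix R assume "R \<in> P"
    then show "(\<integral>\<^sup>+ \<epsilon>. ennreal (\<psi> R \<epsilon>) \<partial>W) \<le> ennreal (2 ^ 18 * 7 ^ 7 * r * (real (card R) + x))"
      using \<psi>(3)[of R] by (simp only: r_def mult_ac)
  qed simp
  also have "(\<Sum>R\<in>P. ennreal (2 ^ 18 * 7 ^ 7 * r * (real (card R) + x))) = ennreal (2 ^ 18 * 7 ^ 7 * r * (2 * real n))"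
  proof -
    have "(\<Sum>R\<in>P. ennreal (2 ^ 18 * 7 ^ 7 * r * (real (card R) + x)))
        = ennreal (\<Sum>R\<in>P. 2 ^ 18 * 7 ^ 7 * r * (real (card R) + x))"
      using r0 x by (intro sum_ennreal) auto
    also have "(\<Sum>R\<in>P. 2 ^ 18 * 7 ^ 7 * r * (real (card R) + x)) = 2 ^ 18 * 7 ^ 7 * r * (real n + real k * x)"
      using P(3) by (simp only: sum_distrib_left[symmetric] sum.distrib sum_constant sum_card)
    also have "real k * x = real n" using k1 by (simp add: x_def)
    finally show ?thesis by simp
  qed
  also have "ennreal (1 / real n) * ennreal (2 ^ 18 * 7 ^ 7 * r * (2 * real n)) = ennreal (2 ^ 19 * 7 ^ 7 * r)"
    using r0 n(2) by (subst ennreal_mult[symmetric]) (auto simp: field_simps)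
  also have "\<dots> \<le> ennreal (2 ^ 19 * 7 ^ 7 * (real k / real n) powr (2 / real d) * log_plus x ^ 8)"
  proof (rule ennreal_leI)
    have "x powr (- 2 / real d) = (real k / real n) powr (2 / real d)"
      using k1 n(2) by (simp add: x_def powr_minus powr_divide)
    moreover have "log_plus x ^ 7 \<le> log_plus x ^ 8"
      using log_plus_ge_1[of x] by (intro power_increasing) auto
    ultimately have "r \<le> (real k / real n) powr (2 / real d) * log_plus x ^ 8"
      unfolding r_def by (simp add: mult_left_mono)
    then have "2 ^ 19 * 7 ^ 7 * r \<le> 2 ^ 19 * 7 ^ 7 * ((real k / real n) powr (2 / real d) * log_plus x ^ 8)"
      by (rule mult_left_mono) simp
    then show "2 ^ 19 * 7 ^ 7 * r \<le> 2 ^ 19 * 7 ^ 7 * (real k / real n) powr (2 / real d) * log_plus x ^ 8"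
      by (simp only: mult.assoc)
  qed
  finally show ?thesis unfolding a_def x_def by (simp add: add_left_mono)
qed

theorem theorem3:
  shows "\<exists>C::real. C > 0 \<and>
    (\<forall>d n n1 :: nat. \<forall>\<theta>0 \<in> extensional (grid d n1).
      d \<ge> 2 \<and> n \<ge> 2 \<and> n = n1 ^ d \<longrightarrow>
      risk d n1 \<theta>0 \<le>
        (INF k\<in>{1..}.
          (INF \<theta>\<in>isotone_pieces d n1 k.
            ennreal ((L2_set (\<lambda>w. \<theta> w - \<theta>0 w) (grid d n1))\<^sup>2 / real n))
          + ennreal (C * (real k / real n) powr (2 / real d) * (log_plus (real n / real k)) ^ 8)))"
proof (intro exI conjI allI ballI impI INF_greatest)
  show "(0::real) < 2 ^ 19 * 7 ^ 7" by simp
next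
  fix d n n1 k :: nat and \<theta>0
  assume "2 \<le> d \<and> 2 \<le> n \<and> n = n1 ^ d"
  then have n: "2 \<le> d" "n = n1 ^ d" "1 \<le> n" by auto
  \<comment> \<open>Subtracting the second summand, which is finite, moves it out of the infimum, also when no \<open>\<theta>\<close> exists.\<close>
  define b where "b = ennreal (2 ^ 19 * 7 ^ 7 * (real k / real n) powr (2 / real d) * (log_plus (real n / real k)) ^ 8)"
  have "b \<noteq> top" by (simp add: b_def)
  then have "risk d n1 \<theta>0 - b \<le> ennreal ((L2_set (\<lambda>w. \<theta> w - \<theta>0 w) (grid d n1))\<^sup>2 / real n)"
    if "\<theta> \<in> isotone_pieces d n1 k" for \<theta>
    using risk_le_piecewise[OF n that, of \<theta>0] by (simp add: ennreal_minus_le_iff b_def add.commute)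
  then have "risk d n1 \<theta>0 - b \<le> (INF \<theta>\<in>isotone_pieces d n1 k.
      ennreal ((L2_set (\<lambda>w. \<theta> w - \<theta>0 w) (grid d n1))\<^sup>2 / real n))"
    by (rule INF_greatest)
  then show "risk d n1 \<theta>0 \<le> (INF \<theta>\<in>isotone_pieces d n1 k.
      ennreal ((L2_set (\<lambda>w. \<theta> w - \<theta>0 w) (grid d n1))\<^sup>2 / real n))
    + ennreal (2 ^ 19 * 7 ^ 7 * (real k / real n) powr (2 / real d) * (log_plus (real n / real k)) ^ 8)"
    unfolding b_def[symmetric] by (simp add: ennreal_minus_le_iff add.commute)
qed

end
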